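(* Let $A \in M_n(\mathbb{R})$ be entrywise nonnegative, irreducible, and imprimitive with index of cyclicity $h$, and let $p > 1$ be an integer. Then $A$ possesses an eventually nonnegative $p$th-root if and only if $A$ possesses a real $p$th-root and $\gcd(h,p) = 1$.
   Context: A $p$th-root of $A$ is a matrix $X$ with $X^p = A$. A real matrix $X$ is eventually nonnegative if there is a nonnegative integer $k_0$ such that $X^k$ is entrywise nonnegative for all $k\ge k_0$. The digraph $\Gamma(A)$ of $A$ has vertex set $\{1,\dots,n\}$ and an arc $(i,j)$ whenever $a_{ij}\ne 0$. $A$ is irreducible if and only if $\Gamma(A)$ is strongly connected. The index of imprimitivity of a strongly connected digraph is the gcd of the lengths of its closed walks. An irreducible nonnegative matrix is imprimitive if the index of imprimitivity of its digraph is greater than one. For $h\ge 2$, $A$ is $h$-cyclic if there is an ordered partition $(\pi_1,\dots,\pi_h)$ of $\{1,\dots,n\}$ into nonempty subsets such that for every arc $(i,j)$ of $\Gamma(A)$ there is $\ell\in\{1,\dots,h\}$ with $i\in\pi_\ell$, $j\in\pi_{\ell+1}$ (where $\pi_{h+1}:=\pi_1$). The index of cyclicity (cyclic index) of $A$ is the largest $h$ for which $A$ is $h$-cyclic; for an irreducible imprimitive nonnegative matrix it equals the index of imprimitivity. *)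

theory Defs
  imports
    "Jordan_Normal_Form.Matrix"
    "Graph_Theory.Arc_Walk"
    "Graph_Theory.Digraph_Component"
    "HOL-Library.Disjoint_Sets"
begin

definition is_root_mat :: "nat \<Rightarrow> 'a::semiring_1 mat \<Rightarrow> 'a mat \<Rightarrow> bool" where
  "is_root_mat p A X \<longleftrightarrow> X \<in> carrier_mat (dim_row A) (dim_row A) \<and> X ^\<^sub>m p = A"

definition nonneg_matrix :: "real mat \<Rightarrow> bool" where
  "nonneg_matrix A \<longleftrightarrow> (\<forall>i < dim_row A. \<forall>j < dim_col A. A $$ (i, j) \<ge> 0)"

definition eventually_nonneg_matrix :: "real mat \<Rightarrow> bool" where
  "eventually_nonneg_matrix X \<longleftrightarrow> (\<exists>k0. \<forall>k \<ge> k0. nonneg_matrix (X ^\<^sub>m k))"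

text \<open>Following the indexing of matrices in the library, the vertices are
  \<open>0, \<dots>, n - 1\<close> rather than \<open>1, \<dots>, n\<close>. An arc is the pair of its end points.\<close>

definition mat_digraph :: "'a::zero mat \<Rightarrow> (nat, nat \<times> nat) pre_digraph" where
  "mat_digraph A =
    \<lparr> verts = {..<dim_row A},
      arcs = {(i, j). i < dim_row A \<and> j < dim_col A \<and> A $$ (i, j) \<noteq> 0},
      tail = fst, head = snd \<rparr>"

definition irreducible_matrix :: "'a::zero mat \<Rightarrow> bool" where
  "irreducible_matrix A \<longleftrightarrow> strongly_connected (mat_digraph A)"

definition imprimitivity_index :: "('a, 'b) pre_digraph \<Rightarrow> nat" where
  "imprimitivity_index G = Gcd {length w | u w. pre_digraph.awalk G u w u}"

text \<open>Used only for irreducible nonnegative matrices.\<close>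

definition imprimitive_matrix :: "real mat \<Rightarrow> bool" where
  "imprimitive_matrix A \<longleftrightarrow> imprimitivity_index (mat_digraph A) > 1"

text \<open>The classes \<open>\<pi> 0, \<dots>, \<pi> (h - 1)\<close> are numbered from \<open>0\<close>, so that the cyclic
  successor of class \<open>l\<close> is \<open>(l + 1) mod h\<close>.\<close>

definition cyclic_matrix :: "nat \<Rightarrow> 'a::zero mat \<Rightarrow> bool" where
  "cyclic_matrix h A \<longleftrightarrow> h \<ge> 2 \<and>
    (\<exists>\<pi> :: nat \<Rightarrow> nat set.
      (\<Union>l<h. \<pi> l) = verts (mat_digraph A) \<and>
      disjoint_family_on \<pi> {..<h} \<and>
      (\<forall>l<h. \<pi> l \<noteq> {}) \<and>
      (\<forall>(i, j) \<in> arcs (mat_digraph A). \<exists>l<h. i \<in> \<pi> l \<and> j \<in> \<pi> ((l + 1) mod h)))"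

text \<open>This is meaningful whenever \<open>A\<close> is \<open>h\<close>-cyclic for at least one \<open>h\<close>, because
  such \<open>h\<close> are bounded by the dimension, as shown below.\<close>

definition cyclic_index :: "'a::zero mat \<Rightarrow> nat" where
  "cyclic_index A = (GREATEST h. cyclic_matrix h A)"

lemma cyclic_matrix_le_dim:
  assumes "cyclic_matrix h A"
  shows "h \<le> dim_row A"
proof -
  from assms obtain \<pi> :: "nat \<Rightarrow> nat set"
    where un: "(\<Union>l<h. \<pi> l) = {..<dim_row A}"
      and dj: "disjoint_family_on \<pi> {..<h}"
      and ne: "\<forall>l<h. \<pi> l \<noteq> {}"
    by (auto simp: cyclic_matrix_def mat_digraph_def)
  define f where "f l = (SOME x. x \<in> \<pi> l)" for l
  have f: "f l \<in> \<pi> l" if "l < h" for l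
    using ne that unfolding f_def by (simp add: some_in_eq)
  have "inj_on f {..<h}"
  proof (rule inj_onI)
    fix l m
    assume l: "l \<in> {..<h}" and m: "m \<in> {..<h}" and "f l = f m"
    then have "f l \<in> \<pi> l \<inter> \<pi> m"
      using f[of l] f[of m] by simp
    then show "l = m"
      using disjoint_family_onD[OF dj l m] by blast
  qed
  moreover have "f ` {..<h} \<subseteq> {..<dim_row A}"
    using f un by blast
  ultimately have "card {..<h} \<le> card {..<dim_row A}"
    by (intro card_inj_on_le) auto
  then show ?thesis
    by simp
qed

lemma cyclic_index_greatest:
  assumes "cyclic_matrix h A"
  shows "cyclic_matrix (cyclic_index A) A" and "h \<le> cyclic_index A"
  using GreatestI_nat[where P = "\<lambda>h. cyclic_matrix h A" and k = h and b = "dim_row A"]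
    Greatest_le_nat[where P = "\<lambda>h. cyclic_matrix h A" and k = h and b = "dim_row A"]
    assms cyclic_matrix_le_dim[of _ A]
  by (simp_all add: cyclic_index_def)

end

theory Submission
  imports Defs "Jordan_Normal_Form.Spectral_Radius" "HOL-Number_Theory.Cong"
begin

text \<open>
Let \<open>h\<close> be the index of imprimitivity of \<open>A\<close>. Sorting the vertices by the length of a walk from
vertex \<open>0\<close>, taken modulo \<open>h\<close>, makes \<open>A\<close> homogeneous of degree one for a grading by \<open>\<int>/h\<close>, and every
sufficiently long walk that the grading permits exists (\<open>cyclic_classes\<close>). The number of classes
is the cyclic index (\<open>cyclic_index_eq_imprimitivity_index\<close>).

Necessity of coprimality. If \<open>X\<close> is an eventually nonnegative root, then \<open>N = X ^ k\<close> is nonnegative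
for some \<open>k\<close> that is \<open>1\<close> modulo \<open>h\<close>, and \<open>N ^ p = A ^ k\<close>. An arc of \<open>N\<close>, followed by a return path in
\<open>A ^ k\<close>, is a closed walk of \<open>N\<close> of length \<open>1 + p t\<close>. Running through it \<open>p\<close> times gives a closed walk
of \<open>A\<close> of length \<open>k (1 + p t)\<close>, so \<open>h\<close> divides \<open>1 + p t\<close>
(\<open>coprime_of_eventually_nonneg_root\<close>).

Sufficiency. The powers of \<open>A\<close> have zeros forced by the grading, so a small error in a power of a
root could be negative there. The remedy is a root \<open>Y\<close> that respects the grading: \<open>A ^ t Y\<close> is
homogeneous of degree \<open>t + r\<close> for large \<open>t\<close>, where \<open>r p = 1\<close> modulo \<open>h\<close>
(\<open>homogeneous_root\<close>). On the nilpotent part of \<open>A\<close> the given root \<open>X\<close> can be kept, because that part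
disappears in high powers. On the invertible part there are two cases.
  \<^item> If \<open>p\<close> is odd, the inverse of \<open>A ^ h\<close> has a real \<open>p\<close>-th root \<open>F\<close> that is a polynomial in
    \<open>A ^ h\<close>, hence of degree zero. With \<open>p r = 1 + h k\<close>, the matrix \<open>A ^ r F ^ k\<close> is a \<open>p\<close>-th root
    of degree \<open>r\<close>.
  \<^item> If \<open>p\<close> is even, then \<open>h\<close> is odd, and the inverse of \<open>A ^ h\<close> has a real \<open>h\<close>-th root \<open>F\<close> of degree
    zero. Then \<open>C = A F\<close> has degree one and \<open>C ^ h = 1\<close>. Multiplying the component of degree \<open>a\<close> of a
    matrix by \<open>C ^ (- a)\<close>, for every \<open>a\<close>, is a ring homomorphism from the commutant of \<open>C\<close> into the
    matrices of degree zero. It maps \<open>X\<close> to a \<open>p\<close>-th root of \<open>A C ^ (- 1)\<close>, and multiplication by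
    \<open>C ^ r\<close> turns this into a root of \<open>A\<close> of degree \<open>r\<close>.

The Perron vector \<open>v\<close> of \<open>A\<close> is an eigenvector of everything that commutes with \<open>A\<close>, so
\<open>Y v = \<sigma> v\<close>, and after a change of sign of \<open>Y\<close> one has \<open>\<sigma> > 0\<close>. Conjugated by \<open>v\<close> and divided by the
Perron root, \<open>A\<close> is stochastic, and the rows of its high powers become equal within each class
(\<open>W_mixing\<close>). Hence an entry of \<open>Y ^ k\<close> that the grading permits has, for large \<open>k\<close>, the sign of
\<open>\<sigma> ^ k > 0\<close>, and all other entries are exactly zero.
\<close>

section \<open>Powers of square matrices\<close>

lemma index_mult_mat_sum:
  fixes A B :: "'a::semiring_0 mat"
  assumes "A \<in> carrier_mat n n" "B \<in> carrier_mat n n" "i < n" "j < n"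
  shows "(A * B) $$ (i, j) = (\<Sum>k<n. A $$ (i, k) * B $$ (k, j))"
  using assms by (auto simp: scalar_prod_def atLeast0LessThan)

lemma pow_mat_add:
  fixes A :: "'a::semiring_1 mat"
  assumes A: "A \<in> carrier_mat n n"
  shows "A ^\<^sub>m (k + l) = A ^\<^sub>m k * A ^\<^sub>m l"
proof (induction l)
  case 0
  then show ?case using A by simp
next
  case (Suc l)
  have "A ^\<^sub>m (k + Suc l) = A ^\<^sub>m k * A ^\<^sub>m l * A"
    using Suc by simp
  also have "\<dots> = A ^\<^sub>m k * (A ^\<^sub>m l * A)"
    using A by (intro assoc_mult_mat[of _ n n _ n _ n] pow_carrier_mat) auto
  finally show ?case by simp
qed

lemma pow_mat_mult:
  fixes A :: "'a::semiring_1 mat"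
  assumes A: "A \<in> carrier_mat n n"
  shows "A ^\<^sub>m (k * l) = (A ^\<^sub>m k) ^\<^sub>m l"
proof (induction l)
  case 0
  then show ?case using A by simp
next
  case (Suc l)
  have "A ^\<^sub>m (k * Suc l) = A ^\<^sub>m (k * l + k)"
    by (simp add: add.commute)
  then show ?case using Suc pow_mat_add[OF A] by simp
qed

lemma pow_mat_commute:
  fixes A B :: "'a::semiring_1 mat"
  assumes A: "A \<in> carrier_mat n n" and B: "B \<in> carrier_mat n n" and AB: "A * B = B * A"
  shows "A ^\<^sub>m k * B = B * A ^\<^sub>m k"
proof (induction k)
  case 0
  then show ?case using A B by simp
next
  case (Suc k)
  note [simp] = assoc_mult_mat[of _ n n _ n _ n] mult_carrier_mat[of _ n n _ n]
  have Ak: "A ^\<^sub>m k \<in> carrier_mat n n" using A by (rule pow_carrier_mat)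
  have "A ^\<^sub>m Suc k * B = A ^\<^sub>m k * (A * B)" using Ak A B by simp
  also have "\<dots> = A ^\<^sub>m k * B * A" using Ak A B AB by simp
  also have "\<dots> = B * A ^\<^sub>m Suc k" using Ak A B Suc by simp
  finally show ?case .
qed

lemma pow_mat_mult_distrib:
  fixes A B :: "'a::semiring_1 mat"
  assumes A: "A \<in> carrier_mat n n" and B: "B \<in> carrier_mat n n" and AB: "A * B = B * A"
  shows "(A * B) ^\<^sub>m k = A ^\<^sub>m k * B ^\<^sub>m k"
proof (induction k)
  case 0
  then show ?case using A B by simp
next
  case (Suc k)
  note [simp] = assoc_mult_mat[of _ n n _ n _ n] mult_carrier_mat[of _ n n _ n]
  have Ak: "A ^\<^sub>m k \<in> carrier_mat n n" and Bk: "B ^\<^sub>m k \<in> carrier_mat n n"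
    using A B by (auto intro: pow_carrier_mat)
  have "(A * B) ^\<^sub>m Suc k = A ^\<^sub>m k * (B ^\<^sub>m k * A) * B" using Suc Ak Bk A B by simp
  also have "B ^\<^sub>m k * A = A * B ^\<^sub>m k"
    using pow_mat_commute[OF B A] AB by simp
  also have "A ^\<^sub>m k * (A * B ^\<^sub>m k) * B = A ^\<^sub>m Suc k * B ^\<^sub>m Suc k"
    using Ak Bk A B by simp
  finally show ?case .
qed

lemma smult_pow_mat:
  fixes A :: "'a::comm_semiring_1 mat"
  assumes A: "A \<in> carrier_mat n n"
  shows "(a \<cdot>\<^sub>m A) ^\<^sub>m k = a ^ k \<cdot>\<^sub>m (A ^\<^sub>m k)"
proof (induction k)
  case 0
  then show ?case using A by (intro eq_matI) auto
next
  case (Suc k)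
  have Ak: "A ^\<^sub>m k \<in> carrier_mat n n" using A by (rule pow_carrier_mat)
  have "(a \<cdot>\<^sub>m A) ^\<^sub>m Suc k = (a ^ k \<cdot>\<^sub>m A ^\<^sub>m k) * (a \<cdot>\<^sub>m A)" using Suc by simp
  also have "\<dots> = a \<cdot>\<^sub>m ((a ^ k \<cdot>\<^sub>m A ^\<^sub>m k) * A)"
    by (rule mult_smult_distrib[OF smult_carrier_mat[OF Ak] A])
  also have "(a ^ k \<cdot>\<^sub>m A ^\<^sub>m k) * A = a ^ k \<cdot>\<^sub>m (A ^\<^sub>m k * A)"
    by (rule mult_smult_assoc_mat[OF Ak A])
  finally show ?case using A by (intro eq_matI) (auto simp del: index_mult_mat(1) simp: mult.assoc)
qed

lemma pow_mat_eigenvector: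
  fixes A :: "'a::comm_semiring_1 mat"
  assumes A: "A \<in> carrier_mat n n"
    and eig: "\<And>i. i < n \<Longrightarrow> (\<Sum>j<n. A $$ (i, j) * x j) = a * x i" and "i < n"
  shows "(\<Sum>j<n. (A ^\<^sub>m k) $$ (i, j) * x j) = a ^ k * x i"
  using \<open>i < n\<close>
proof (induction k arbitrary: i)
  case 0
  have "(\<Sum>j<n. (A ^\<^sub>m 0) $$ (i, j) * x j) = (\<Sum>j<n. if j = i then x i else 0)"
    using A 0 by (intro sum.cong) auto
  then show ?case using 0 by simp
next
  case (Suc k)
  have "(\<Sum>j<n. (A ^\<^sub>m Suc k) $$ (i, j) * x j)
      = (\<Sum>j<n. \<Sum>l<n. (A ^\<^sub>m k) $$ (i, l) * (A $$ (l, j) * x j))"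
    using Suc.prems
    by (simp add: index_mult_mat_sum[OF pow_carrier_mat[OF A] A] sum_distrib_right mult.assoc
        del: index_mult_mat(1))
  also have "\<dots> = (\<Sum>l<n. \<Sum>j<n. (A ^\<^sub>m k) $$ (i, l) * (A $$ (l, j) * x j))"
    by (rule sum.swap)
  also have "\<dots> = (\<Sum>l<n. (A ^\<^sub>m k) $$ (i, l) * (a * x l))"
    by (intro sum.cong) (simp_all add: eig flip: sum_distrib_left)
  also have "\<dots> = a * (\<Sum>l<n. (A ^\<^sub>m k) $$ (i, l) * x l)"
    by (simp add: sum_distrib_left ac_simps)
  finally show ?case using Suc by (simp add: mult.assoc)
qed

section \<open>Numerical semigroups\<close>

text \<open>
The least positive difference \<open>\<delta>\<close> of two elements of \<open>S\<close> divides every element of \<open>S\<close>, since the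
remainder of a division by \<open>\<delta>\<close> is again such a difference.
\<close>

lemma Gcd_eq_diff_of_additive:
  fixes S :: "nat set"
  assumes add: "\<And>x y. x \<in> S \<Longrightarrow> y \<in> S \<Longrightarrow> x + y \<in> S"
    and zero: "0 \<in> S" and pos: "Gcd S > 0"
  shows "\<exists>y. y \<in> S \<and> y + Gcd S \<in> S"
proof -
  define D where "D = {d. d > 0 \<and> (\<exists>y\<in>S. y + d \<in> S)}"
  have mul: "k * x \<in> S" if "x \<in> S" for k x
    by (induction k) (use that zero add in auto)
  obtain s where s: "s \<in> S" "s > 0"
  proof -
    have "\<not> S \<subseteq> {0}" using pos by (metis Gcd_0_iff less_irrefl)
    then show ?thesis using that by auto
  qed
  then have "s \<in> D" using zero by (auto simp: D_def intro!: bexI[of _ 0])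
  define \<delta> where "\<delta> = (LEAST d. d \<in> D)"
  have \<delta>D: "\<delta> \<in> D" unfolding \<delta>_def by (rule LeastI[of _ s]) fact
  have least: "\<delta> \<le> d" if "d \<in> D" for d unfolding \<delta>_def using that by (rule Least_le)
  from \<delta>D obtain y where y: "y \<in> S" "y + \<delta> \<in> S" and d0: "\<delta> > 0" by (auto simp: D_def)
  have dv: "\<delta> dvd x" if x: "x \<in> S" for x
  proof (rule ccontr)
    assume "\<not> \<delta> dvd x"
    then have r: "x mod \<delta> > 0" by (simp add: dvd_eq_mod_eq_0)
    let ?q = "x div \<delta>"
    have "?q * y + x = ?q * (y + \<delta>) + x mod \<delta>"
      by (simp add: algebra_simps)
    moreover have "?q * y + x \<in> S" "?q * (y + \<delta>) \<in> S" using mul y x add by auto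
    ultimately have "x mod \<delta> \<in> D" using r unfolding D_def by auto
    from least[OF this] have "\<delta> \<le> x mod \<delta>" .
    moreover have "x mod \<delta> < \<delta>" using d0 by simp
    ultimately show False by simp
  qed
  then have "\<delta> dvd Gcd S" by (simp add: Gcd_greatest)
  moreover have "Gcd S dvd \<delta>" using y
    by (metis Gcd_dvd dvd_add_right_iff)
  ultimately show ?thesis using y by (metis dvd_antisym)
qed

lemma additive_contains_large_multiples_of_Gcd:
  fixes S :: "nat set"
  assumes add: "\<And>x y. x \<in> S \<Longrightarrow> y \<in> S \<Longrightarrow> x + y \<in> S"
    and zero: "0 \<in> S" and pos: "Gcd S > 0"
  shows "\<exists>M. \<forall>m\<ge>M. Gcd S dvd m \<longrightarrow> m \<in> S"
proof -
  obtain y where y: "y \<in> S" "y + Gcd S \<in> S"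
    using Gcd_eq_diff_of_additive[OF assms] by blast
  have mul: "k * x \<in> S" if "x \<in> S" for k x
    by (induction k) (use that zero add in auto)
  obtain y' where y': "y = Gcd S * y'" using y(1) by (meson Gcd_dvd dvdE)
  show ?thesis
  proof (intro exI allI impI)
    fix m assume m: "m \<ge> Gcd S * (y' * y')" and "Gcd S dvd m"
    then obtain k where k: "m = Gcd S * k" by blast
    show "m \<in> S"
    proof (cases "y' = 0")
      case True
      then have "m = k * (y + Gcd S)" using y' k by simp
      then show ?thesis using mul y by simp
    next
      case False
      \<comment> \<open>Write \<open>k = q y' + s\<close> with \<open>s < y' \<le> q\<close> and use \<open>s\<close> copies of \<open>y + Gcd S\<close>.\<close>
      let ?q = "k div y'" and ?s = "k mod y'"
      have "y' * y' \<le> k" using m k pos by simp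
      then have "y' \<le> ?q" using False by (simp add: less_eq_div_iff_mult_less_eq)
      moreover have "?s < y'" using False by simp
      ultimately have "?s \<le> ?q" by linarith
      then obtain t where t: "?q = ?s + t" using le_Suc_ex by blast
      have "(?q - ?s) * y + ?s * (y + Gcd S) = ?q * y + ?s * Gcd S"
        unfolding t by (simp only: add_diff_cancel_left' algebra_simps)
      also have "\<dots> = Gcd S * (?q * y' + ?s)" unfolding y' by (simp only: algebra_simps)
      also have "\<dots> = m" unfolding k by (simp only: div_mult_mod_eq)
      finally have "(?q - ?s) * y + ?s * (y + Gcd S) = m" .
      moreover have "(?q - ?s) * y + ?s * (y + Gcd S) \<in> S"
        by (intro add mul y)
      ultimately show ?thesis by simp
    qed
  qed
qed

section \<open>Walks and positive entries\<close>

lemma nonneg_matrix_iff: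
  "A \<in> carrier_mat n n \<Longrightarrow> nonneg_matrix A \<longleftrightarrow> (\<forall>i<n. \<forall>j<n. 0 \<le> A $$ (i, j))"
  by (auto simp: nonneg_matrix_def)

lemma nonneg_matrix_mult:
  assumes "A \<in> carrier_mat n n" "B \<in> carrier_mat n n" "nonneg_matrix A" "nonneg_matrix B"
  shows "nonneg_matrix (A * B)"
  using assms
  by (auto simp: nonneg_matrix_iff[of _ n] index_mult_mat_sum[of _ n] simp del: index_mult_mat(1)
      intro!: sum_nonneg mult_nonneg_nonneg)

lemma nonneg_matrix_pow:
  assumes A: "A \<in> carrier_mat n n" and nn: "nonneg_matrix A"
  shows "nonneg_matrix (A ^\<^sub>m k)"
proof (induction k)
  case 0
  then show ?case using A by (auto simp: nonneg_matrix_def)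
next
  case (Suc k)
  then show ?case using nonneg_matrix_mult[OF pow_carrier_mat[OF A] A _ nn] by simp
qed

text \<open>
The products in an entry of a product of nonnegative matrices cannot cancel, so positive entries
compose like arcs.
\<close>

lemma mult_entry_pos_iff:
  assumes A: "A \<in> carrier_mat n n" and B: "B \<in> carrier_mat n n"
    and "nonneg_matrix A" "nonneg_matrix B" and i: "i < n" and j: "j < n"
  shows "(A * B) $$ (i, j) > 0 \<longleftrightarrow> (\<exists>k<n. A $$ (i, k) > 0 \<and> B $$ (k, j) > 0)"
proof -
  have nn: "0 \<le> A $$ (i, k) * B $$ (k, j)" if "k < n" for k
    using assms that by (auto simp: nonneg_matrix_iff[of _ n])
  have "(A * B) $$ (i, j) > 0 \<longleftrightarrow> (A * B) $$ (i, j) \<noteq> 0"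
    using nonneg_matrix_mult[OF A B assms(3,4)] mult_carrier_mat[OF A B] i j
    by (auto simp: nonneg_matrix_iff[of _ n] less_le)
  also have "\<dots> \<longleftrightarrow> (\<exists>k<n. A $$ (i, k) * B $$ (k, j) \<noteq> 0)"
    using nn sum_nonneg_eq_0_iff[of "{..<n}" "\<lambda>k. A $$ (i, k) * B $$ (k, j)"]
    unfolding index_mult_mat_sum[OF A B i j] by auto
  also have "\<dots> \<longleftrightarrow> (\<exists>k<n. A $$ (i, k) > 0 \<and> B $$ (k, j) > 0)"
  proof -
    have "0 \<le> A $$ (i, k)" "0 \<le> B $$ (k, j)" if "k < n" for k
      using assms that by (auto simp: nonneg_matrix_iff[of _ n])
    then have "A $$ (i, k) * B $$ (k, j) \<noteq> 0 \<longleftrightarrow> A $$ (i, k) > 0 \<and> B $$ (k, j) > 0" if "k < n" for k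
      using that by (metis less_eq_real_def less_irrefl mult_eq_0_iff)
    then show ?thesis by auto
  qed
  finally show ?thesis .
qed

lemma pow_add_entry_pos_iff:
  assumes A: "A \<in> carrier_mat n n" and nn: "nonneg_matrix A" and "i < n" "j < n"
  shows "(A ^\<^sub>m (a + b)) $$ (i, j) > 0 \<longleftrightarrow>
    (\<exists>k<n. (A ^\<^sub>m a) $$ (i, k) > 0 \<and> (A ^\<^sub>m b) $$ (k, j) > 0)"
  unfolding pow_mat_add[OF A]
  by (intro mult_entry_pos_iff pow_carrier_mat nonneg_matrix_pow[OF A nn] assms)

lemma pow_entry_pos_iff_awalk:
  assumes A: "A \<in> carrier_mat n n" and nn: "nonneg_matrix A" and "i < n" "j < n"
  shows "(A ^\<^sub>m m) $$ (i, j) > 0 \<longleftrightarrow>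
    (\<exists>w. pre_digraph.awalk (mat_digraph A) i w j \<and> length w = m)"
  using \<open>i < n\<close>
proof (induction m arbitrary: i)
  case 0
  then show ?case using A \<open>j < n\<close>
    by (auto simp: pre_digraph.awalk_def mat_digraph_def pre_digraph.cas.simps)
next
  case (Suc m)
  have arc: "A $$ (i, k) > 0 \<longleftrightarrow> (i, k) \<in> arcs (mat_digraph A)" if "k < n" for k
    using Suc.prems that nn A by (auto simp: mat_digraph_def nonneg_matrix_iff[of _ n] less_le)
  have in_arcs: "snd e < n" "fst e < n" if "e \<in> arcs (mat_digraph A)" for e
    using that A by (auto simp: mat_digraph_def)
  have hd: "head (mat_digraph A) = snd" "tail (mat_digraph A) = fst" "verts (mat_digraph A) = {..<n}"
    using A by (auto simp: mat_digraph_def)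
  have "(A ^\<^sub>m Suc m) $$ (i, j) > 0 \<longleftrightarrow> (\<exists>k<n. A $$ (i, k) > 0 \<and> (A ^\<^sub>m m) $$ (k, j) > 0)"
    using pow_add_entry_pos_iff[OF A nn Suc.prems \<open>j < n\<close>, of 1 m] A by simp
  also have "\<dots> \<longleftrightarrow> (\<exists>k<n. (i, k) \<in> arcs (mat_digraph A) \<and>
      (\<exists>w. pre_digraph.awalk (mat_digraph A) k w j \<and> length w = m))"
    using Suc.IH arc by blast
  also have "\<dots> \<longleftrightarrow> (\<exists>w. pre_digraph.awalk (mat_digraph A) i w j \<and> length w = Suc m)"
  proof
    assume "\<exists>k<n. (i, k) \<in> arcs (mat_digraph A) \<and>
      (\<exists>w. pre_digraph.awalk (mat_digraph A) k w j \<and> length w = m)"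
    then obtain k w where "k < n" "(i, k) \<in> arcs (mat_digraph A)"
      "pre_digraph.awalk (mat_digraph A) k w j" "length w = m" by blast
    then have "pre_digraph.awalk (mat_digraph A) i ((i, k) # w) j"
      using Suc.prems by (auto simp: pre_digraph.awalk_def hd pre_digraph.cas.simps)
    then show "\<exists>w. pre_digraph.awalk (mat_digraph A) i w j \<and> length w = Suc m"
      using \<open>length w = m\<close> by (intro exI[of _ "(i, k) # w"]) simp
  next
    assume "\<exists>w. pre_digraph.awalk (mat_digraph A) i w j \<and> length w = Suc m"
    then obtain e w where w: "pre_digraph.awalk (mat_digraph A) i (e # w) j" "length w = m"
      by (metis length_Suc_conv)
    then have "e = (i, snd e)" "e \<in> arcs (mat_digraph A)"
      "pre_digraph.awalk (mat_digraph A) (snd e) w j"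
      using in_arcs by (auto simp: pre_digraph.awalk_def hd pre_digraph.cas.simps)
    then show "\<exists>k<n. (i, k) \<in> arcs (mat_digraph A) \<and>
      (\<exists>w. pre_digraph.awalk (mat_digraph A) k w j \<and> length w = m)"
      using w in_arcs by metis
  qed
  finally show ?case .
qed

lemma imprimitivity_index_eq_Gcd:
  assumes A: "A \<in> carrier_mat n n" and nn: "nonneg_matrix A"
  shows "imprimitivity_index (mat_digraph A) = Gcd {m. \<exists>i<n. (A ^\<^sub>m m) $$ (i, i) > 0}"
proof -
  have lt: "i < n" if "pre_digraph.awalk (mat_digraph A) i w i" for i w
    using that A by (auto simp: pre_digraph.awalk_def mat_digraph_def)
  have iff: "(A ^\<^sub>m m) $$ (i, i) > 0 \<longleftrightarrow> (\<exists>w. pre_digraph.awalk (mat_digraph A) i w i \<and> length w = m)"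
    if "i < n" for i m
    using pow_entry_pos_iff_awalk[OF A nn that that] .
  have "{length w | u w. pre_digraph.awalk (mat_digraph A) u w u} =
      {m. \<exists>i<n. (A ^\<^sub>m m) $$ (i, i) > 0}"
  proof (intro subset_antisym subsetI)
    fix m assume "m \<in> {length w | u w. pre_digraph.awalk (mat_digraph A) u w u}"
    then obtain u w where "m = length w" "pre_digraph.awalk (mat_digraph A) u w u" by blast
    then show "m \<in> {m. \<exists>i<n. (A ^\<^sub>m m) $$ (i, i) > 0}"
      using iff[OF lt, of u w m] lt[of u w] by auto
  next
    fix m assume "m \<in> {m. \<exists>i<n. (A ^\<^sub>m m) $$ (i, i) > 0}"
    then show "m \<in> {length w | u w. pre_digraph.awalk (mat_digraph A) u w u}"
      using iff by fastforce
  qed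
  then show ?thesis by (simp add: imprimitivity_index_def)
qed

lemma irreducible_pow_entry_pos:
  assumes A: "A \<in> carrier_mat n n" and nn: "nonneg_matrix A" and irr: "irreducible_matrix A"
    and "i < n" "j < n"
  shows "\<exists>m. (A ^\<^sub>m m) $$ (i, j) > 0"
proof -
  interpret wf_digraph "mat_digraph A"
    by unfold_locales (use A in \<open>auto simp: mat_digraph_def\<close>)
  have "i \<rightarrow>\<^sup>*\<^bsub>mat_digraph A\<^esub> j"
    using irr assms A by (auto simp: irreducible_matrix_def strongly_connected_def mat_digraph_def)
  then show ?thesis
    using pow_entry_pos_iff_awalk[OF A nn \<open>i < n\<close> \<open>j < n\<close>] by (auto simp: reachable_awalk)
qed

lemma irreducible_dim_pos:
  assumes "A \<in> carrier_mat n n" "irreducible_matrix A"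
  shows "n > 0"
  using assms by (auto simp: irreducible_matrix_def strongly_connected_def mat_digraph_def)

section \<open>The cyclic grading of an irreducible matrix\<close>

lemma cong_add_self_iff: "[a = a + m] (mod h) \<longleftrightarrow> h dvd m" for a m h :: nat
  by (metis cong_0_iff cong_add_lcancel_0_nat cong_sym_eq)

text \<open>
The map \<open>c\<close> places every index into a class modulo \<open>h\<close>, and \<open>M\<close> raises the class by \<open>a\<close>. Classes and
degrees are natural numbers of which only the residues matter; the degree \<open>- a\<close> is written as
\<open>(h - 1) * a\<close>.
\<close>

definition homogeneous :: "nat \<Rightarrow> (nat \<Rightarrow> nat) \<Rightarrow> nat \<Rightarrow> 'a::zero mat \<Rightarrow> bool" where
  "homogeneous h c a M \<longleftrightarrow>
    (\<forall>i<dim_row M. \<forall>j<dim_col M. M $$ (i, j) \<noteq> 0 \<longrightarrow> [c j = c i + a] (mod h))"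

lemma homogeneousD:
  assumes "homogeneous h c a M" "M \<in> carrier_mat n n" "i < n" "j < n" "M $$ (i, j) \<noteq> 0"
  shows "[c j = c i + a] (mod h)"
  using assms by (auto simp: homogeneous_def)

lemma homogeneousI:
  assumes "M \<in> carrier_mat n n"
    and "\<And>i j. i < n \<Longrightarrow> j < n \<Longrightarrow> M $$ (i, j) \<noteq> 0 \<Longrightarrow> [c j = c i + a] (mod h)"
  shows "homogeneous h c a M"
  using assms by (auto simp: homogeneous_def)

lemma homogeneous_one: "homogeneous h c 0 (1\<^sub>m n)"
  by (auto simp: homogeneous_def split: if_splits)

lemma homogeneous_mult:
  fixes M N :: "'a::semiring_0 mat"
  assumes M: "M \<in> carrier_mat n n" and N: "N \<in> carrier_mat n n"
    and hM: "homogeneous h c a M" and hN: "homogeneous h c b N"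
  shows "homogeneous h c (a + b) (M * N)"
proof (rule homogeneousI[OF mult_carrier_mat[OF M N]])
  fix i j assume ij: "i < n" "j < n" and "(M * N) $$ (i, j) \<noteq> 0"
  then have "(\<Sum>k<n. M $$ (i, k) * N $$ (k, j)) \<noteq> 0"
    using M N by (simp add: index_mult_mat_sum[of _ n] del: index_mult_mat(1))
  then obtain k where "k < n" "M $$ (i, k) * N $$ (k, j) \<noteq> 0"
    by (metis (no_types, lifting) lessThan_iff sum.neutral)
  then have k: "[c k = c i + a] (mod h)" "[c j = c k + b] (mod h)"
    using homogeneousD[OF hM M ij(1)] homogeneousD[OF hN N _ ij(2)]
    by (metis mult_zero_left, metis mult_zero_right)
  have "[c k + b = c i + a + b] (mod h)" using k(1) by (simp add: cong_add_rcancel_nat)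
  then show "[c j = c i + (a + b)] (mod h)"
    using k(2) by (metis add.assoc cong_trans)
qed

lemma homogeneous_pow:
  fixes M :: "'a::semiring_1 mat"
  assumes M: "M \<in> carrier_mat n n" and hM: "homogeneous h c a M"
  shows "homogeneous h c (a * k) (M ^\<^sub>m k)"
proof (induction k)
  case 0
  then show ?case using M by (simp add: homogeneous_one)
next
  case (Suc k)
  then show ?case using homogeneous_mult[OF pow_carrier_mat[OF M] M Suc hM] by (simp add: add.commute)
qed

lemma homogeneous_cong:
  assumes "homogeneous h c a M" "[a = b] (mod h)"
  shows "homogeneous h c b M"
  using assms unfolding homogeneous_def by (meson cong_add_lcancel_nat cong_trans)

text \<open>
The class \<open>c i\<close> is the length of a walk from \<open>0\<close> to \<open>i\<close>. Modulo \<open>d\<close> it does not depend on the walk: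
two such walks become closed walks by the same return walk. The lengths of the closed walks at
\<open>0\<close> alone have greatest common divisor \<open>d\<close>, because a closed walk elsewhere can be inserted into one
at \<open>0\<close>; being closed under addition, they contain all large multiples of \<open>d\<close>. A detour through \<open>0\<close>
transfers this to walks between arbitrary vertices.
\<close>

lemma cyclic_classes:
  assumes A: "A \<in> carrier_mat n n" and nn: "nonneg_matrix A" and irr: "irreducible_matrix A"
    and d: "d = imprimitivity_index (mat_digraph A)" and "d > 0"
  obtains c M where "homogeneous d c 1 A" "c 0 = 0"
    "\<And>m i j. M \<le> m \<Longrightarrow> i < n \<Longrightarrow> j < n \<Longrightarrow> [c j = c i + m] (mod d) \<Longrightarrow> (A ^\<^sub>m m) $$ (i, j) > 0"
proof -
  note add_iff = pow_add_entry_pos_iff[OF A nn]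
  note reach = irreducible_pow_entry_pos[OF A nn irr]
  have n0: "0 < n" using irreducible_dim_pos[OF A irr] .
  have closed: "d dvd m" if "i < n" "(A ^\<^sub>m m) $$ (i, i) > 0" for m i
    unfolding d imprimitivity_index_eq_Gcd[OF A nn] using that by (intro Gcd_dvd) auto
  have trans: "(A ^\<^sub>m (a + b)) $$ (i, k) > 0"
    if "(A ^\<^sub>m a) $$ (i, j) > 0" "(A ^\<^sub>m b) $$ (j, k) > 0" "i < n" "j < n" "k < n" for a b i j k
    using that add_iff by blast
  define c where "c i = (if i = 0 then 0 else (SOME m. (A ^\<^sub>m m) $$ (0, i) > 0))" for i
  have c: "(A ^\<^sub>m c i) $$ (0, i) > 0" if "i < n" for i
    using someI_ex[OF reach[OF n0 that]] n0 A by (auto simp: c_def)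
  define b where "b i = (SOME m. (A ^\<^sub>m m) $$ (i, 0) > 0)" for i
  have b: "(A ^\<^sub>m b i) $$ (i, 0) > 0" if "i < n" for i
    using someI_ex[OF reach[OF that n0]] by (auto simp: b_def)
  have hom: "[c j = c i + m] (mod d)" if "i < n" "j < n" "(A ^\<^sub>m m) $$ (i, j) > 0" for i j m
  proof -
    have "d dvd c i + m + b j"
      by (rule closed[OF n0 trans[OF trans[OF c that(3)] b]]) (use that n0 in auto)
    moreover have "d dvd c j + b j"
      by (rule closed[OF n0 trans[OF c b]]) (use that n0 in auto)
    ultimately have "[c j + b j = c i + m + b j] (mod d)"
      by (metis cong_0_iff cong_sym cong_trans)
    then show ?thesis by (simp only: cong_add_rcancel_nat)
  qed
  define S where "S = {m. (A ^\<^sub>m m) $$ (0, 0) > 0}"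
  have "Gcd S = d"
  proof (rule dvd_antisym)
    show "d dvd Gcd S" unfolding S_def using closed n0 by (auto intro!: Gcd_greatest)
    show "Gcd S dvd d" unfolding d imprimitivity_index_eq_Gcd[OF A nn]
    proof (rule Gcd_greatest, safe)
      fix m i assume i: "i < n" "(A ^\<^sub>m m) $$ (i, i) > 0"
      then have "(c i + m) + b i \<in> S" "c i + b i \<in> S"
        using n0 b c by (auto simp: S_def intro!: trans[of _ 0 i])
      then have "Gcd S dvd m + (c i + b i)" "Gcd S dvd c i + b i"
        by (auto simp: algebra_simps intro: Gcd_dvd)
      then show "Gcd S dvd m" by (simp add: dvd_add_left_iff)
    qed
  qed
  moreover have "0 \<in> S" using A n0 by (simp add: S_def)
  moreover have "x + y \<in> S" if "x \<in> S" "y \<in> S" for x y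
    using that n0 by (auto simp: S_def intro: trans)
  ultimately obtain M where M: "\<And>m. m \<ge> M \<Longrightarrow> d dvd m \<Longrightarrow> m \<in> S"
    using additive_contains_large_multiples_of_Gcd[of S] \<open>d > 0\<close> by metis
  define M' where "M' = M + (\<Sum>i<n. b i) + (\<Sum>i<n. c i)"
  show ?thesis
  proof
    show "c 0 = 0" by (simp add: c_def)
    show "homogeneous d c 1 A"
      using hom[of _ _ 1] A nn by (intro homogeneousI[OF A]) (auto simp: nonneg_matrix_iff[of _ n] less_le)
    fix m i j assume m: "M' \<le> m" and ij: "i < n" "j < n" and cg: "[c j = c i + m] (mod d)"
    have "b i \<le> (\<Sum>i<n. b i)" "c j \<le> (\<Sum>i<n. c i)"
      using ij by (auto intro!: member_le_sum)
    then have le: "M + b i + c j \<le> m" using m by (simp add: M'_def)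
    have "d dvd c i + b i" using closed[OF n0] trans[OF c b] ij n0 by blast
    have "[c i + b i + (m - b i - c j) + c j = c i + m] (mod d)"
      using le by simp
    then have "[c i + b i + (m - b i - c j) + c j = 0 + c j] (mod d)"
      using cg by (metis add_0 cong_sym cong_trans)
    then have "d dvd c i + b i + (m - b i - c j)"
      by (metis cong_0_iff cong_add_rcancel_nat)
    then have "d dvd m - b i - c j" using \<open>d dvd c i + b i\<close> by (simp add: dvd_add_right_iff)
    then have "m - b i - c j \<in> S" using M le by simp
    then have "(A ^\<^sub>m (b i + (m - b i - c j) + c j)) $$ (i, j) > 0"
      using ij n0 b c by (auto simp: S_def intro!: trans[of _ i 0 _ j] trans[of _ i 0 _ 0])
    then show "(A ^\<^sub>m m) $$ (i, j) > 0" using le by simp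
  qed
qed

text \<open>
The classes of the grading are a cyclic partition into \<open>d\<close> parts. Conversely, a cyclic partition
into \<open>h\<close> parts is a grading modulo \<open>h\<close> with \<open>A\<close> of degree one, so \<open>h\<close> divides the length of every
closed walk and therefore \<open>d\<close>.
\<close>

lemma cyclic_index_eq_imprimitivity_index:
  assumes A: "A \<in> carrier_mat n n" and nn: "nonneg_matrix A" and irr: "irreducible_matrix A"
    and imp: "imprimitive_matrix A"
  shows "cyclic_index A = imprimitivity_index (mat_digraph A)"
proof -
  define d where "d = imprimitivity_index (mat_digraph A)"
  have d2: "d \<ge> 2" using imp by (simp add: imprimitive_matrix_def d_def)
  obtain c M where c: "homogeneous d c 1 A" "c 0 = 0" and M: "\<And>m i j. M \<le> m \<Longrightarrow> i < n \<Longrightarrow> j < n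
      \<Longrightarrow> [c j = c i + m] (mod d) \<Longrightarrow> (A ^\<^sub>m m) $$ (i, j) > 0"
    using cyclic_classes[OF A nn irr d_def] d2 by auto
  have n0: "0 < n" using irreducible_dim_pos[OF A irr] .
  define \<pi> where "\<pi> l = {i. i < n \<and> c i mod d = l}" for l
  have ne: "\<pi> l \<noteq> {}" if "l < d" for l
  proof -
    have "l \<le> M * d + d" using that by simp
    moreover have "(A ^\<^sub>m (M * d + d)) $$ (0, 0) > 0"
      using d2 n0 by (intro M) (auto simp: cong_add_self_iff trans_le_add1)
    ultimately obtain k where k: "k < n" "(A ^\<^sub>m l) $$ (0, k) > 0"
      using pow_add_entry_pos_iff[OF A nn n0 n0, of l "M * d + d - l"] by auto
    then have "[c k = c 0 + 1 * l] (mod d)"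
      using homogeneousD[OF homogeneous_pow[OF A c(1)] pow_carrier_mat[OF A] n0 k(1), of l] by simp
    then show ?thesis using k c(2) that by (auto simp: \<pi>_def cong_def)
  qed
  have "cyclic_matrix d A" unfolding cyclic_matrix_def
  proof (intro conjI exI[of _ \<pi>])
    show "(\<Union>l<d. \<pi> l) = verts (mat_digraph A)" using A d2 by (auto simp: \<pi>_def mat_digraph_def)
    show "disjoint_family_on \<pi> {..<d}" by (auto simp: disjoint_family_on_def \<pi>_def)
    show "\<forall>(i, j)\<in>arcs (mat_digraph A). \<exists>l<d. i \<in> \<pi> l \<and> j \<in> \<pi> ((l + 1) mod d)"
    proof safe
      fix i j assume "(i, j) \<in> arcs (mat_digraph A)"
      then have ij: "i < n" "j < n" "A $$ (i, j) \<noteq> 0" using A by (auto simp: mat_digraph_def)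
      then have "[c j = c i + 1] (mod d)" using homogeneousD[OF c(1) A] by blast
      then show "\<exists>l<d. i \<in> \<pi> l \<and> j \<in> \<pi> ((l + 1) mod d)"
        using ij d2 by (intro exI[of _ "c i mod d"]) (auto simp: \<pi>_def cong_def mod_simps)
    qed
  qed (use ne d2 in auto)
  note gr = cyclic_index_greatest[OF this]
  define h where "h = cyclic_index A"
  from gr(1) obtain \<sigma> where h2: "h \<ge> 2" and un: "(\<Union>l<h. \<sigma> l) = verts (mat_digraph A)"
    and dj: "disjoint_family_on \<sigma> {..<h}"
    and ar: "\<forall>(i, j)\<in>arcs (mat_digraph A). \<exists>l<h. i \<in> \<sigma> l \<and> j \<in> \<sigma> ((l + 1) mod h)"
    unfolding cyclic_matrix_def h_def by blast
  define e where "e i = (THE l. l < h \<and> i \<in> \<sigma> l)" for i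
  have e: "e i = l" if "l < h" "i \<in> \<sigma> l" for i l
    unfolding e_def using that dj by (intro the_equality) (auto simp: disjoint_family_on_def)
  have "homogeneous h e 1 A"
  proof (rule homogeneousI[OF A])
    fix i j assume "i < n" "j < n" "A $$ (i, j) \<noteq> 0"
    then have "(i, j) \<in> arcs (mat_digraph A)" using A by (auto simp: mat_digraph_def)
    then obtain l where l: "l < h" "i \<in> \<sigma> l" "j \<in> \<sigma> ((l + 1) mod h)" using ar by blast
    then have "e i = l" "e j = (l + 1) mod h" using e h2 by auto
    then show "[e j = e i + 1] (mod h)" by (simp add: cong_def)
  qed
  then have "h dvd m" if "i < n" "(A ^\<^sub>m m) $$ (i, i) > 0" for i m
    using homogeneousD[OF homogeneous_pow[OF A, of h e 1 m] pow_carrier_mat[OF A] that(1) that(1)] that(2)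
    by (auto simp: cong_add_self_iff)
  then have "h dvd d" unfolding d_def imprimitivity_index_eq_Gcd[OF A nn] by (intro Gcd_greatest) auto
  then have "h \<le> d" using d2 by (intro dvd_imp_le) auto
  then show ?thesis using gr(2) by (simp add: h_def d_def)
qed

section \<open>Eventually nonnegative roots force coprimality\<close>

text \<open>
A common divisor of \<open>h\<close> and \<open>p\<close> divides \<open>p t\<close>; it also divides \<open>1 + p t\<close> as soon as some nonnegative
power \<open>X ^ k\<close>, with \<open>k\<close> prime to \<open>h\<close>, has a closed walk of that length.
\<close>

lemma coprime_of_eventually_nonneg_root:
  assumes A: "A \<in> carrier_mat n n" and nn: "nonneg_matrix A" and irr: "irreducible_matrix A"
    and h: "h = imprimitivity_index (mat_digraph A)" and "h > 0"
    and X: "X \<in> carrier_mat n n" and XA: "X ^\<^sub>m p = A" and ev: "eventually_nonneg_matrix X" and p: "p > 1"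
  shows "gcd h p = 1"
proof -
  obtain c M where c: "homogeneous h c 1 A" and M: "\<And>m i j. M \<le> m \<Longrightarrow> i < n \<Longrightarrow> j < n
      \<Longrightarrow> [c j = c i + m] (mod h) \<Longrightarrow> (A ^\<^sub>m m) $$ (i, j) > 0"
    using cyclic_classes[OF A nn irr h \<open>h > 0\<close>] by metis
  have n0: "0 < n" using irreducible_dim_pos[OF A irr] .
  obtain k0 where k0: "\<And>k. k \<ge> k0 \<Longrightarrow> nonneg_matrix (X ^\<^sub>m k)"
    using ev by (auto simp: eventually_nonneg_matrix_def)
  define k where "k = Suc (h * (k0 + M))"
  define N where "N = X ^\<^sub>m k"
  have N: "N \<in> carrier_mat n n" using X by (simp add: N_def pow_carrier_mat)
  have "k0 + M \<le> h * (k0 + M)" using \<open>h > 0\<close> by simp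
  then have "k \<ge> k0" unfolding k_def by linarith
  then have Nnn: "nonneg_matrix N" using k0 by (simp add: N_def)
  have Npm: "N ^\<^sub>m (p * m) = A ^\<^sub>m (k * m)" for m
  proof -
    have "N ^\<^sub>m (p * m) = X ^\<^sub>m (p * (k * m))"
      using pow_mat_mult[OF X, of k "p * m"] by (simp add: N_def algebra_simps)
    then show ?thesis using pow_mat_mult[OF X] XA by simp
  qed
  have "M \<le> k * (h * M + h)"
  proof -
    have "M * 1 \<le> M * (h * k)"
      using \<open>h > 0\<close> by (intro mult_le_mono2) (simp add: k_def Suc_leI)
    also have "\<dots> \<le> k * (h * M + h)" by (simp add: algebra_simps)
    finally show ?thesis by simp
  qed
  moreover have "h dvd k * (h * M + h)" by simp
  ultimately have "(A ^\<^sub>m (k * (h * M + h))) $$ (0, 0) > 0"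
    using n0 by (intro M) (auto simp: cong_add_self_iff)
  then have "(N ^\<^sub>m (1 + (p * (h * M + h) - 1))) $$ (0, 0) > 0"
    using Npm \<open>h > 0\<close> p by simp
  then obtain j where j: "j < n" "N $$ (0, j) > 0"
    using pow_add_entry_pos_iff[OF N Nnn n0 n0, of 1 "p * (h * M + h) - 1"] N by auto
  \<comment> \<open>Close the arc \<open>(0, j)\<close> of \<open>N\<close> by a walk of \<open>A ^ k\<close> back to \<open>0\<close>, of length \<open>t\<close>.\<close>
  obtain t where t: "[c 0 = c j + t] (mod h)" "t \<ge> M"
  proof
    have le: "c j \<le> h * c j" using \<open>h > 0\<close> by simp
    then have "c j + (h * M + h * c j + c 0 - c j) = c 0 + h * (M + c j)"
      unfolding distrib_left by linarith
    then show "[c 0 = c j + (h * M + h * c j + c 0 - c j)] (mod h)"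
      by (simp add: cong_add_self_iff)
    show "h * M + h * c j + c 0 - c j \<ge> M"
      using le \<open>h > 0\<close> by (cases h) auto
  qed
  have "[1 = 1 + h * (k0 + M)] (mod h)" by (simp only: cong_add_self_iff dvd_triv_left)
  then have "[k = 1] (mod h)" by (simp add: k_def cong_sym)
  then have "[k * t = 1 * t] (mod h)" by (rule cong_scalar_right)
  then have "[c 0 = c j + k * t] (mod h)"
    using t(1) by (metis cong_add_lcancel_nat cong_sym cong_trans mult_1)
  moreover have "k * t \<ge> M" using t(2) by (simp add: k_def)
  ultimately have "(N ^\<^sub>m (p * t)) $$ (j, 0) > 0" using M j n0 Npm by simp
  then have "(N ^\<^sub>m (1 + p * t)) $$ (0, 0) > 0"
    using pow_add_entry_pos_iff[OF N Nnn n0 n0, of 1 "p * t"] j N by auto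
  then have L: "((N ^\<^sub>m (1 + p * t)) ^\<^sub>m q) $$ (0, 0) > 0" for q
  proof (induction q)
    case 0
    then show ?case using N n0 by simp
  next
    case (Suc q)
    then show ?case
      using mult_entry_pos_iff[of "(N ^\<^sub>m (1 + p * t)) ^\<^sub>m q" n "N ^\<^sub>m (1 + p * t)" 0 0] N Nnn n0
      by (auto intro!: pow_carrier_mat nonneg_matrix_pow[of _ n] simp del: pow_mat.simps(2) simp: pow_mat.simps(2)[of _ q])
  qed
  have "(A ^\<^sub>m (k * (1 + p * t))) $$ (0, 0) > 0"
    using L[of p] Npm[of "1 + p * t"] pow_mat_mult[OF N, of "1 + p * t" p] by (simp add: mult.commute)
  then have "[c 0 = c 0 + 1 * (k * (1 + p * t))] (mod h)"
    using homogeneousD[OF homogeneous_pow[OF A c] pow_carrier_mat[OF A] n0 n0] by force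
  then have "h dvd k * (1 + p * t)"
    by (simp only: cong_add_self_iff mult_1)
  moreover have "coprime h k"
    using \<open>[k = 1] (mod h)\<close> by (metis cong_imp_coprime coprime_1_left coprime_commute cong_sym)
  ultimately have "h dvd 1 + p * t" by (metis coprime_dvd_mult_right_iff)
  then have "gcd h p dvd 1 + p * t" by (meson dvd_trans gcd_dvd1)
  then have "gcd h p dvd 1" by (meson dvd_add_left_iff dvd_mult2 gcd_dvd2)
  then show ?thesis by simp
qed

section \<open>Odd roots modulo a real polynomial\<close>

definition ceval :: "real poly \<Rightarrow> complex \<Rightarrow> complex" where
  "ceval f z = poly (map_poly of_real f) z"

lemma ceval_pCons [simp]: "ceval (pCons a f) z = of_real a + z * ceval f z"
  by (simp add: ceval_def of_real_hom.map_poly_pCons_hom)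

lemma ceval_0 [simp]: "ceval 0 z = 0"
  by (simp add: ceval_def)

lemma ceval_1 [simp]: "ceval 1 z = 1"
  by (simp add: one_pCons)

lemma ceval_add [simp]: "ceval (f + g) z = ceval f z + ceval g z"
  by (induction f g rule: poly_induct2) (simp_all add: algebra_simps)

lemma ceval_smult [simp]: "ceval (smult a f) z = of_real a * ceval f z"
  by (induction f) (simp_all add: algebra_simps)

lemma ceval_diff [simp]: "ceval (f - g) z = ceval f z - ceval g z"
  using ceval_add[of "f - g" g z] by simp

lemma ceval_mult [simp]: "ceval (f * g) z = ceval f z * ceval g z"
  by (induction f) (simp_all add: algebra_simps)

lemma ceval_power [simp]: "ceval (f ^ k) z = ceval f z ^ k"
  by (induction k) simp_all

lemma ceval_of_nat [simp]: "ceval (of_nat k) z = of_nat k"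
  by (induction k) simp_all

lemma ceval_real: "z \<in> \<real> \<Longrightarrow> ceval f z \<in> \<real>"
  by (induction f) auto

lemma ceval_interpolate:
  assumes "z \<in> \<real> \<longrightarrow> y \<in> \<real>"
  shows "\<exists>t. ceval t z = y"
proof (cases "z \<in> \<real>")
  case True
  then have "ceval [:Re y:] z = y" using assms by (simp add: complex_is_Real_iff complex_eq_iff)
  then show ?thesis ..
next
  case False
  then have "Im z \<noteq> 0" by (simp add: complex_is_Real_iff)
  then have "ceval [:Re y - Im y / Im z * Re z, Im y / Im z:] z = y"
    by (simp add: complex_eq_iff)
  then show ?thesis ..
qed

text \<open>
The polynomial \<open>g\<close> is \<open>w - z\<close> for real \<open>z\<close> and \<open>(w - z) (w - cnj z)\<close> otherwise. In the second case a
real remainder of degree at most one that vanishes at \<open>z\<close> is zero, by comparing imaginary parts.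
\<close>

lemma real_minimal_polynomial:
  "\<exists>g. degree g > 0 \<and> (\<forall>k. ceval k z = 0 \<longleftrightarrow> g dvd k)"
proof (cases "z \<in> \<real>")
  case True
  then have z: "z = of_real (Re z)" by (simp add: complex_is_Real_iff complex_eq_iff)
  have "ceval k z = of_real (poly k (Re z))" for k
    by (subst z, induction k) simp_all
  then show ?thesis
    by (intro exI[of _ "[:- Re z, 1:]"]) (auto simp: poly_eq_0_iff_dvd)
next
  case False
  then have im: "Im z \<noteq> 0" by (simp add: complex_is_Real_iff)
  define g where "g = [:(Re z)\<^sup>2 + (Im z)\<^sup>2, - 2 * Re z, 1:]"
  have deg: "degree g = 2" and "g \<noteq> 0" by (simp_all add: g_def)
  have g0: "ceval g z = 0"
    by (simp add: g_def complex_eq_iff power2_eq_square algebra_simps)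
  show ?thesis
  proof (intro exI[of _ g] conjI allI)
    fix k
    define r where "r = k mod g"
    have k: "k = g * (k div g) + r" by (simp only: r_def mult_div_mod_eq)
    have "degree r < 2"
      using degree_mod_less'[of g k] deg \<open>g \<noteq> 0\<close> unfolding r_def by (cases "k mod g = 0") auto
    then have r: "r = [:coeff r 0, coeff r 1:]"
      by (intro poly_eqI) (auto simp: coeff_pCons coeff_eq_0 split: nat.split)
    have "ceval k z = ceval r z" using arg_cong[OF k, of "\<lambda>f. ceval f z"] g0 by simp
    also have "ceval r z = of_real (coeff r 0) + z * of_real (coeff r 1)"
      by (subst r) simp
    also have "\<dots> = 0 \<longleftrightarrow> coeff r 0 = 0 \<and> coeff r 1 = 0"
      using im by (auto simp: complex_eq_iff)
    also have "\<dots> \<longleftrightarrow> r = 0" by (subst (3) r) simp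
    finally show "ceval k z = 0 \<longleftrightarrow> g dvd k" by (simp add: r_def dvd_eq_mod_eq_0)
  qed (simp add: deg)
qed

text \<open>
The root at a real \<open>z\<close> has to be real again, which is what the odd exponent provides.
\<close>

lemma complex_odd_root:
  assumes "odd q" and "z \<noteq> 0"
  obtains y :: complex where "z * y ^ q = 1" "z \<in> \<real> \<longrightarrow> y \<in> \<real>"
proof (cases "z \<in> \<real>")
  case True
  then obtain x where x: "z = of_real x" by (rule Reals_cases)
  have "root q (1 / x) ^ q = 1 / x" using assms(1) by (rule odd_real_root_pow)
  then have "x * root q (1 / x) ^ q = 1" using assms(2) x by simp
  then have "z * of_real (root q (1 / x)) ^ q = 1"
    unfolding x by (metis of_real_1 of_real_mult of_real_power)
  then show ?thesis by (rule that) (simp add: x)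
next
  case False
  define y where "y = rcis (root q (cmod (1 / z))) (Arg (1 / z) / q)"
  have q: "q > 0" using assms(1) by (rule odd_pos)
  have "y ^ q = rcis (cmod (1 / z)) (Arg (1 / z))"
    using q unfolding y_def DeMoivre2 by simp
  then have "y ^ q = 1 / z" by (simp only: rcis_cmod_Arg)
  then have "z * y ^ q = 1" using assms(2) by simp
  then show ?thesis using that False by blast
qed

text \<open>
The expansion behind Newton's correction of an approximate root.
\<close>

lemma power_add_second_order:
  fixes a b :: "'a::comm_ring_1"
  shows "\<exists>s. (a + b) ^ q = a ^ q + of_nat q * a ^ (q - 1) * b + b\<^sup>2 * s"
proof (induction q)
  case 0
  then show ?case by (intro exI[of _ 0]) simp
next
  case (Suc q)
  then obtain s where s: "(a + b) ^ q = a ^ q + of_nat q * a ^ (q - 1) * b + b\<^sup>2 * s" by blast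
  have "(a + b) ^ Suc q = (a + b) * (a ^ q + of_nat q * a ^ (q - 1) * b + b\<^sup>2 * s)"
    by (simp only: power_Suc s)
  also have "\<dots> = a ^ Suc q + of_nat (Suc q) * a ^ q * b
      + b\<^sup>2 * (of_nat q * a ^ (q - 1) + (a + b) * s)"
    by (cases q) (simp_all add: power2_eq_square algebra_simps)
  finally show ?case by auto
qed

text \<open>
Modulo \<open>\<psi>\<close> the variable \<open>w\<close> is a unit, and the powers \<open>f ^ q\<close> include its inverse. The proof removes one
complex root \<open>z\<close> of \<open>\<psi>\<close>, together with its conjugate, so that \<open>\<psi> = g \<phi>\<close>, and corrects a solution \<open>f\<close>
modulo \<open>\<phi>\<close> by a multiple \<open>t \<phi>\<close>. Only the value of \<open>t\<close> at \<open>z\<close> matters. It is determined by the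
Chinese remainder theorem if \<open>\<phi>\<close> does not vanish at \<open>z\<close>, and by Newton's method otherwise; it is real for real \<open>z\<close>,
so that \<open>t\<close> can be taken real.
\<close>

lemma odd_root_of_inverse_mod_poly:
  fixes \<psi> :: "real poly"
  assumes "poly \<psi> 0 \<noteq> 0" and q: "odd q"
  shows "\<exists>f. \<psi> dvd [:0, 1:] * f ^ q - 1"
  using assms(1)
proof (induction "degree \<psi>" arbitrary: \<psi> rule: less_induct)
  case less
  let ?X = "[:0, 1:] :: real poly"
  have q0: "q > 0" using q by (rule odd_pos)
  have "\<psi> \<noteq> 0" using less.prems by auto
  show ?case
  proof (cases "degree \<psi> = 0")
    case True
    then have "is_unit \<psi>" using \<open>\<psi> \<noteq> 0\<close> is_unit_iff_degree by blast
    then show ?thesis by (meson unit_imp_dvd)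
  next
    case False
    have "degree (map_poly complex_of_real \<psi>) = degree \<psi>" by (rule degree_map_poly) simp
    then have "\<not> constant (poly (map_poly complex_of_real \<psi>))"
      using False by (simp add: constant_degree)
    then obtain z where z: "ceval \<psi> z = 0"
      using fundamental_theorem_of_algebra unfolding ceval_def by blast
    have "ceval \<psi> 0 = of_real (poly \<psi> 0)" by (cases \<psi>) simp
    then have z0: "z \<noteq> 0" using z less.prems by auto
    obtain g where g: "degree g > 0" "\<And>k. ceval k z = 0 \<longleftrightarrow> g dvd k"
      using real_minimal_polynomial[of z] by blast
    then obtain \<phi> where \<phi>: "\<psi> = g * \<phi>" using z by blast
    have "degree \<phi> < degree \<psi>"
      using \<open>\<psi> \<noteq> 0\<close> g(1) unfolding \<phi> by (subst degree_mult_eq) auto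
    moreover have "poly \<phi> 0 \<noteq> 0" using less.prems by (simp add: \<phi>)
    ultimately obtain f where "\<phi> dvd ?X * f ^ q - 1" using less.hyps by blast
    then obtain k where k: "?X * f ^ q - 1 = \<phi> * k" by blast
    have kz: "z * ceval f z ^ q - 1 = ceval \<phi> z * ceval k z"
      using arg_cong[OF k, of "\<lambda>f. ceval f z"] by simp
    show ?thesis
    proof (cases "ceval \<phi> z = 0")
      case False
      \<comment> \<open>Chinese remainders: keep \<open>f\<close> modulo \<open>\<phi>\<close> and prescribe a root of \<open>1 / z\<close> at \<open>z\<close>.\<close>
      obtain y where y: "z * y ^ q = 1" "z \<in> \<real> \<longrightarrow> y \<in> \<real>" using complex_odd_root[OF q z0] .
      obtain t where t: "ceval t z = (y - ceval f z) / ceval \<phi> z"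
        using ceval_interpolate[of z "(y - ceval f z) / ceval \<phi> z"] y(2) ceval_real[of z] by auto
      let ?f = "f + t * \<phi>"
      have "?f - f dvd ?f ^ q - f ^ q" by (subst power_diff_sumr2) (rule dvd_triv_left)
      then have "\<phi> dvd ?f ^ q - f ^ q"
        unfolding add_diff_cancel_left' by (rule dvd_mult_right)
      then have "\<phi> dvd ?X * (?f ^ q - f ^ q) + (?X * f ^ q - 1)"
        using k by (intro dvd_add dvd_mult) auto
      then have "\<phi> dvd ?X * ?f ^ q - 1" by (simp add: algebra_simps)
      then obtain k' where k': "?X * ?f ^ q - 1 = \<phi> * k'" by blast
      have "ceval ?f z = y" using t False by simp
      then have "ceval \<phi> z * ceval k' z = 0"
        using arg_cong[OF k', of "\<lambda>f. ceval f z"] y(1) by simp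
      then have "g dvd k'" using False g(2) by simp
      then have "\<psi> dvd ?X * ?f ^ q - 1" unfolding k' \<phi> by (simp add: mult.commute mult_dvd_mono)
      then show ?thesis ..
    next
      case True
      \<comment> \<open>Newton's correction at a repeated root; \<open>f\<close> does not vanish at \<open>z\<close>.\<close>
      have fz: "ceval f z \<noteq> 0" using kz True q0 by (auto simp: power_0_left)
      define y where "y = - ceval k z / (of_nat q * z * ceval f z ^ (q - 1))"
      obtain t where t: "ceval t z = y"
        using ceval_interpolate[of z y] ceval_real[of z] unfolding y_def by auto
      obtain s where s: "(f + t * \<phi>) ^ q
          = f ^ q + of_nat q * f ^ (q - 1) * (t * \<phi>) + (t * \<phi>)\<^sup>2 * s"
        using power_add_second_order by blast
      define k' where "k' = k + ?X * of_nat q * f ^ (q - 1) * t + ?X * t\<^sup>2 * \<phi> * s"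
      have "?X * (f + t * \<phi>) ^ q - 1 = (?X * f ^ q - 1)
          + \<phi> * (?X * of_nat q * f ^ (q - 1) * t + ?X * t\<^sup>2 * \<phi> * s)"
        unfolding s by (simp only: algebra_simps power2_eq_square)
      also have "\<dots> = \<phi> * k'" unfolding k k'_def by (simp only: algebra_simps)
      finally have eq: "?X * (f + t * \<phi>) ^ q - 1 = \<phi> * k'" .
      have "ceval k' z = ceval k z + z * of_nat q * ceval f z ^ (q - 1) * y"
        using True t by (simp add: k'_def)
      also have "\<dots> = 0" using q0 z0 fz by (simp add: y_def)
      finally have "g dvd k'" using g(2) by simp
      then have "\<psi> dvd ?X * (f + t * \<phi>) ^ q - 1"
        unfolding eq \<phi> by (simp add: mult.commute mult_dvd_mono)
      then show ?thesis ..
    qed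
  qed
qed

section \<open>Odd roots on the invertible part of a real matrix\<close>

definition mat_eval :: "'a::comm_ring_1 poly \<Rightarrow> 'a mat \<Rightarrow> 'a mat" where
  "mat_eval f B = fold_coeffs (\<lambda>a M. a \<cdot>\<^sub>m 1\<^sub>m (dim_row B) + B * M) f (0\<^sub>m (dim_row B) (dim_row B))"

lemma mat_eval_0: "B \<in> carrier_mat n n \<Longrightarrow> mat_eval 0 B = 0\<^sub>m n n"
  by (simp add: mat_eval_def)

lemma mat_eval_pCons:
  assumes "B \<in> carrier_mat n n"
  shows "mat_eval (pCons a f) B = a \<cdot>\<^sub>m 1\<^sub>m n + B * mat_eval f B"
proof (cases "a = 0 \<and> f = 0")
  case True
  then have "mat_eval (pCons a f) B = 0\<^sub>m n n" "B * mat_eval f B = 0\<^sub>m n n"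
    using assms by (simp_all add: mat_eval_0)
  then show ?thesis using True by (intro eq_matI) auto
next
  case False
  then show ?thesis using assms by (auto simp: mat_eval_def)
qed

lemma mat_eval_carrier [simp]: "B \<in> carrier_mat n n \<Longrightarrow> mat_eval f B \<in> carrier_mat n n"
  by (induction f) (simp_all add: mat_eval_0 mat_eval_pCons mult_carrier_mat[of _ n n _ n])

lemma mat_eval_dim [simp]:
  assumes "B \<in> carrier_mat n n"
  shows "dim_row (mat_eval f B) = n" "dim_col (mat_eval f B) = n"
  using mat_eval_carrier[OF assms, of f] by auto

lemma mat_eval_add:
  assumes B: "B \<in> carrier_mat n n"
  shows "mat_eval (f + g) B = mat_eval f B + mat_eval g B"
proof (induction f g rule: poly_induct2)
  case 0
  then show ?case using B by (simp add: mat_eval_0)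
next
  case (pCons a f b g)
  have c: "B * mat_eval f B \<in> carrier_mat n n" "B * mat_eval g B \<in> carrier_mat n n"
    using B by (auto intro: mult_carrier_mat)
  have "B * (mat_eval f B + mat_eval g B) = B * mat_eval f B + B * mat_eval g B"
    using B by (intro mult_add_distrib_mat[of _ n n _ n]) auto
  then show ?case using B c pCons
    by (auto intro!: eq_matI simp del: index_mult_mat(1) simp: mat_eval_pCons algebra_simps)
qed

lemma mat_eval_smult:
  assumes B: "B \<in> carrier_mat n n"
  shows "mat_eval (smult a f) B = a \<cdot>\<^sub>m mat_eval f B"
proof (induction f)
  case 0
  then show ?case using B by (simp add: mat_eval_0)
next
  case (pCons b f)
  have c: "B * mat_eval f B \<in> carrier_mat n n"
    using B by (auto intro: mult_carrier_mat)
  have "B * (a \<cdot>\<^sub>m mat_eval f B) = a \<cdot>\<^sub>m (B * mat_eval f B)"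
    using B by (intro mult_smult_distrib[of _ n n _ n]) auto
  then show ?case using B c pCons
    by (auto intro!: eq_matI simp del: index_mult_mat(1) simp: mat_eval_pCons algebra_simps)
qed

lemma mat_eval_mult:
  assumes B: "B \<in> carrier_mat n n"
  shows "mat_eval (f * g) B = mat_eval f B * mat_eval g B"
proof (induction f)
  case 0
  then show ?case using B left_mult_zero_mat[OF mat_eval_carrier[OF B, of g], of n] by (simp add: mat_eval_0)
next
  case (pCons a f)
  note G = mat_eval_carrier[OF B, of g] and F = mat_eval_carrier[OF B, of f]
  have BF: "B * mat_eval f B \<in> carrier_mat n n" using B F by (rule mult_carrier_mat)
  have "(a \<cdot>\<^sub>m 1\<^sub>m n + B * mat_eval f B) * mat_eval g B
      = (a \<cdot>\<^sub>m 1\<^sub>m n) * mat_eval g B + (B * mat_eval f B) * mat_eval g B"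
    using G BF by (intro add_mult_distrib_mat[of _ n n _ _ n]) auto
  also have "(a \<cdot>\<^sub>m 1\<^sub>m n) * mat_eval g B = a \<cdot>\<^sub>m mat_eval g B"
    using G by (simp add: mult_smult_assoc_mat[of _ n n _ n])
  also have "(B * mat_eval f B) * mat_eval g B = B * mat_eval (f * g) B"
    unfolding pCons(2) by (rule assoc_mult_mat[OF B F G])
  finally have "(a \<cdot>\<^sub>m 1\<^sub>m n + B * mat_eval f B) * mat_eval g B
      = a \<cdot>\<^sub>m mat_eval g B + (0 \<cdot>\<^sub>m 1\<^sub>m n + B * mat_eval (f * g) B)"
    using mult_carrier_mat[OF B mat_eval_carrier[OF B, of "f * g"]] B
    by (auto intro!: eq_matI simp del: index_mult_mat(1))
  then show ?case
    using B by (simp add: mat_eval_add mat_eval_smult mat_eval_pCons mult_pCons_left)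
qed

lemma mat_eval_one: "B \<in> carrier_mat n n \<Longrightarrow> mat_eval 1 B = 1\<^sub>m n"
  by (intro eq_matI) (auto simp: one_pCons mat_eval_pCons mat_eval_0)

lemma mat_eval_power:
  assumes B: "B \<in> carrier_mat n n"
  shows "mat_eval (f ^ k) B = mat_eval f B ^\<^sub>m k"
proof (induction k)
  case 0
  then show ?case using B by (simp add: mat_eval_one mat_eval_carrier[OF B, THEN carrier_matD(1)])
next
  case (Suc k)
  then show ?case using B by (simp only: power_Suc2 mat_eval_mult pow_mat.simps)
qed

lemma mat_eval_X: "B \<in> carrier_mat n n \<Longrightarrow> mat_eval [:0, 1:] B = B"
  by (intro eq_matI) (auto simp: mat_eval_pCons mat_eval_0)

lemma mat_eval_monom: "B \<in> carrier_mat n n \<Longrightarrow> mat_eval (monom a k) B = a \<cdot>\<^sub>m (B ^\<^sub>m k)"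
proof -
  assume B: "B \<in> carrier_mat n n"
  have "monom a k = smult a ([:0, 1:] ^ k)" by (simp add: monom_altdef)
  then show ?thesis using B by (simp add: mat_eval_smult mat_eval_power mat_eval_X)
qed

lemma mat_eval_commute:
  assumes B: "B \<in> carrier_mat n n" and M: "M \<in> carrier_mat n n" and MB: "M * B = B * M"
  shows "M * mat_eval f B = mat_eval f B * M"
proof (induction f)
  case 0
  then show ?case using B M by (simp add: mat_eval_0)
next
  case (pCons a f)
  note F = mat_eval_carrier[OF B, of f]
  have BF: "B * mat_eval f B \<in> carrier_mat n n" using B F by (rule mult_carrier_mat)
  have "M * (a \<cdot>\<^sub>m 1\<^sub>m n + B * mat_eval f B) = M * (a \<cdot>\<^sub>m 1\<^sub>m n) + M * (B * mat_eval f B)"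
    using M BF by (intro mult_add_distrib_mat[of _ n n _ n]) auto
  also have "M * (a \<cdot>\<^sub>m 1\<^sub>m n) = (a \<cdot>\<^sub>m 1\<^sub>m n) * M"
    using M by (simp add: mult_smult_assoc_mat[of _ n n _ n] mult_smult_distrib[of _ n n _ n])
  also have "M * (B * mat_eval f B) = (M * B) * mat_eval f B"
    by (rule assoc_mult_mat[OF M B F, symmetric])
  also have "\<dots> = B * (M * mat_eval f B)" unfolding MB by (rule assoc_mult_mat[OF B M F])
  also have "\<dots> = (B * mat_eval f B) * M"
    unfolding pCons(2) by (rule assoc_mult_mat[OF B F M, symmetric])
  also have "(a \<cdot>\<^sub>m 1\<^sub>m n) * M + (B * mat_eval f B) * M = (a \<cdot>\<^sub>m 1\<^sub>m n + B * mat_eval f B) * M"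
    using M BF by (intro add_mult_distrib_mat[symmetric, of _ n n _ _ n]) auto
  finally show ?case using B by (simp add: mat_eval_pCons)
qed

text \<open>
The \<open>n\<^sup>2 + 1\<close> matrices \<open>B ^ k\<close> with \<open>k \<le> n\<^sup>2\<close> have \<open>n\<^sup>2\<close> entries each and are therefore linearly dependent.
\<close>

lemma exists_annihilating_poly:
  fixes B :: "'a::field mat"
  assumes B: "B \<in> carrier_mat n n"
  shows "\<exists>f. f \<noteq> 0 \<and> mat_eval f B = 0\<^sub>m n n"
proof -
  define N where "N = Suc (n * n)"
  \<comment> \<open>The column \<open>k\<close> lists the entries of \<open>B ^ k\<close>; the last row is zero.\<close>
  define R where "R r = vec N (\<lambda>k. (B ^\<^sub>m k) $$ (r div n, r mod n))" for r
  define M where "M = mat\<^sub>r N N (\<lambda>r. if r = n * n then 0\<^sub>v N else R r)"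
  have M: "M \<in> carrier_mat N N" by (simp add: M_def)
  have "det M = 0" unfolding M_def
    by (rule det_row_0) (auto simp: N_def R_def)
  then obtain v where v: "v \<in> carrier_vec N" "v \<noteq> 0\<^sub>v N" "M *\<^sub>v v = 0\<^sub>v N"
    using det_0_iff_vec_prod_zero[OF M] by blast
  define f where "f K = (\<Sum>k<K. monom (v $ k) k)" for K
  have coeff: "coeff (f N) k = v $ k" if "k < N" for k
    using that by (simp add: f_def coeff_sum)
  have "f N \<noteq> 0"
  proof
    assume "f N = 0"
    then have "v = 0\<^sub>v N" using coeff v(1) by (intro eq_vecI) auto
    then show False using v(2) by simp
  qed
  moreover have "mat_eval (f N) B = 0\<^sub>m n n"
  proof (rule eq_matI)
    fix i j assume "i < dim_row (0\<^sub>m n n :: 'a mat)" "j < dim_col (0\<^sub>m n n :: 'a mat)"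
    then have ij: "i < n" "j < n" by simp_all
    have "mat_eval (f K) B $$ (i, j) = (\<Sum>k<K. v $ k * (B ^\<^sub>m k) $$ (i, j))" for K
    proof (induction K)
      case 0
      then show ?case using B ij by (simp add: f_def mat_eval_0)
    next
      case (Suc K)
      have "f (Suc K) = f K + monom (v $ K) K" by (simp add: f_def)
      then have "mat_eval (f (Suc K)) B = mat_eval (f K) B + v $ K \<cdot>\<^sub>m (B ^\<^sub>m K)"
        using B by (simp add: mat_eval_add mat_eval_monom)
      then show ?case using Suc B ij mat_eval_carrier[OF B, of "f K"] by simp
    qed
    moreover have "i * n + j < n * n"
    proof -
      have "i * n + j < Suc i * n" using ij by simp
      also have "\<dots> \<le> n * n" using ij by (intro mult_le_mono1) simp
      finally show ?thesis .
    qed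
    moreover have "(M *\<^sub>v v) $ (i * n + j) = (\<Sum>k<N. (B ^\<^sub>m k) $$ (i, j) * v $ k)"
    proof -
      have "(M *\<^sub>v v) $ (i * n + j) = R (i * n + j) \<bullet> v"
        using \<open>i * n + j < n * n\<close> by (simp add: M_def N_def R_def)
      also have "\<dots> = (\<Sum>k<N. (B ^\<^sub>m k) $$ (i, j) * v $ k)"
        using v(1) ij by (auto simp: R_def scalar_prod_def atLeast0LessThan)
      finally show ?thesis .
    qed
    ultimately show "mat_eval (f N) B $$ (i, j) = 0\<^sub>m n n $$ (i, j)"
      using v(3) ij by (simp add: N_def mult.commute)
  qed (use mat_eval_carrier[OF B, of "f N"] in auto)
  ultimately show ?thesis by blast
qed

text \<open>
This is Fitting's decomposition with a root: \<open>e\<close> projects onto the part on which \<open>B\<close> is invertible,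
and \<open>F\<close> is there a \<open>q\<close>-th root of the inverse of \<open>B\<close>. Both are polynomials in \<open>B\<close>. What is recorded
of this is that they commute with every matrix that commutes with \<open>B\<close>; this makes them preserve
every grading for which \<open>B\<close> has degree zero and commute with every root of \<open>B\<close>.

Write an annihilating polynomial of \<open>B\<close> as \<open>w ^ m * \<psi>\<close> with \<open>\<psi>\<close> not vanishing at \<open>0\<close>, and let
\<open>w f ^ q\<close> be \<open>1\<close> modulo \<open>\<psi>\<close>. Then \<open>(w f ^ q) ^ m\<close> is divisible by \<open>w ^ m\<close> and is \<open>1\<close> modulo \<open>\<psi>\<close>,
which makes it idempotent.
\<close>

lemma odd_root_on_invertible_part:
  fixes B :: "real mat"
  assumes B: "B \<in> carrier_mat n n" and q: "odd q"
  obtains e F m where "e \<in> carrier_mat n n" "F \<in> carrier_mat n n"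
    "\<And>M. M \<in> carrier_mat n n \<Longrightarrow> M * B = B * M \<Longrightarrow> M * e = e * M \<and> M * F = F * M"
    "e * e = e" "F * e = F" "B * F ^\<^sub>m q = e" "B ^\<^sub>m m * e = B ^\<^sub>m m"
proof -
  let ?X = "[:0, 1:] :: real poly"
  have q0: "q > 0" using q by (rule odd_pos)
  obtain \<chi> where "\<chi> \<noteq> 0" and \<chi>: "mat_eval \<chi> B = 0\<^sub>m n n" using exists_annihilating_poly[OF B] by blast
  define m where "m = order 0 \<chi>"
  obtain \<psi> where \<psi>: "\<chi> = ?X ^ m * \<psi>" "\<not> ?X dvd \<psi>"
    using order_decomp[OF \<open>\<chi> \<noteq> 0\<close>, of 0] by (auto simp: m_def)
  then have "poly \<psi> 0 \<noteq> 0" by (simp add: poly_eq_0_iff_dvd)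
  then obtain f where f: "\<psi> dvd ?X * f ^ q - 1" using odd_root_of_inverse_mod_poly q by blast
  define \<epsilon> where "\<epsilon> = (?X * f ^ q) ^ m"
  have "?X ^ m dvd ?X ^ m * (f ^ q) ^ m" by (rule dvd_triv_left)
  then have X\<epsilon>: "?X ^ m dvd \<epsilon>" by (simp only: \<epsilon>_def power_mult_distrib)
  have \<psi>pow: "\<psi> dvd y ^ k - 1" if "\<psi> dvd y - 1" for y k
    by (rule dvd_trans[OF that]) (use power_diff_sumr2[of y k 1] in simp)
  have \<psi>\<epsilon>: "\<psi> dvd \<epsilon> - 1" unfolding \<epsilon>_def by (rule \<psi>pow[OF f])
  have eqI: "mat_eval a B = mat_eval b B" if "\<chi> dvd a - b" for a b
  proof -
    obtain k where "a = b + \<chi> * k" using \<open>\<chi> dvd a - b\<close> by (metis add.commute diff_add_cancel dvdE)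
    then have "mat_eval a B = mat_eval b B + 0\<^sub>m n n * mat_eval k B"
      using B \<chi> by (simp add: mat_eval_add mat_eval_mult)
    also have "0\<^sub>m n n * mat_eval k B = 0\<^sub>m n n" by (rule left_mult_zero_mat[OF mat_eval_carrier[OF B]])
    finally show ?thesis using mat_eval_carrier[OF B, of b] by simp
  qed
  show ?thesis
  proof (rule that[of "mat_eval \<epsilon> B" "mat_eval (f * \<epsilon>) B" m])
    show "mat_eval \<epsilon> B * mat_eval \<epsilon> B = mat_eval \<epsilon> B"
    proof -
      have "\<chi> dvd \<epsilon> * (\<epsilon> - 1)" unfolding \<psi>(1) using X\<epsilon> \<psi>\<epsilon> by (rule mult_dvd_mono)
      then have "mat_eval (\<epsilon> * \<epsilon>) B = mat_eval \<epsilon> B" by (intro eqI) (simp add: algebra_simps)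
      then show ?thesis using B by (simp add: mat_eval_mult)
    qed
    show "mat_eval (f * \<epsilon>) B * mat_eval \<epsilon> B = mat_eval (f * \<epsilon>) B"
    proof -
      have "\<chi> dvd (f * \<epsilon>) * (\<epsilon> - 1)" unfolding \<psi>(1) using dvd_mult[OF X\<epsilon>] \<psi>\<epsilon> by (rule mult_dvd_mono)
      then have "mat_eval (f * \<epsilon> * \<epsilon>) B = mat_eval (f * \<epsilon>) B" by (intro eqI) (simp add: algebra_simps)
      then show ?thesis using B by (simp add: mat_eval_mult)
    qed
    show "B * mat_eval (f * \<epsilon>) B ^\<^sub>m q = mat_eval \<epsilon> B"
    proof -
      obtain q' where q': "q = Suc q'" using q0 by (cases q) auto
      have "\<psi> dvd ?X * f ^ q * (\<epsilon> ^ q' - 1) + (?X * f ^ q - 1)"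
        using f \<psi>pow[OF \<psi>\<epsilon>] by (intro dvd_add dvd_mult)
      then have "\<chi> dvd \<epsilon> * (?X * f ^ q * (\<epsilon> ^ q' - 1) + (?X * f ^ q - 1))"
        unfolding \<psi>(1) using X\<epsilon> by (intro mult_dvd_mono)
      also have "\<epsilon> * (?X * f ^ q * (\<epsilon> ^ q' - 1) + (?X * f ^ q - 1)) = ?X * (f * \<epsilon>) ^ q - \<epsilon>"
        unfolding q' by (simp only: power_mult_distrib power_Suc algebra_simps)
      finally have "mat_eval (?X * (f * \<epsilon>) ^ q) B = mat_eval \<epsilon> B" by (rule eqI)
      then show ?thesis using B by (simp only: mat_eval_mult mat_eval_power mat_eval_X)
    qed
    show "B ^\<^sub>m m * mat_eval \<epsilon> B = B ^\<^sub>m m"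
    proof -
      have "\<chi> dvd ?X ^ m * (\<epsilon> - 1)" unfolding \<psi>(1) using \<psi>\<epsilon> by (intro mult_dvd_mono) auto
      then have "mat_eval (?X ^ m * \<epsilon>) B = mat_eval (?X ^ m) B" by (intro eqI) (simp add: algebra_simps)
      then show ?thesis using B by (simp only: mat_eval_mult mat_eval_power mat_eval_X)
    qed
  qed (use B mat_eval_commute[OF B] in auto)
qed

section \<open>Roots that respect the grading\<close>

text \<open>
The classes are the eigenspaces of a diagonal matrix, so degree zero means commuting with that
matrix. In this form the property passes from \<open>B\<close> to the bicommutant of \<open>B\<close>.
\<close>

lemma homogeneous_0_iff_commute:
  fixes M :: "real mat" and h :: nat and c :: "nat \<Rightarrow> nat"
  assumes M: "M \<in> carrier_mat n n"
  defines "D \<equiv> mat n n (\<lambda>(i, j). if i = j then real (c i mod h) else 0)"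
  shows "homogeneous h c 0 M \<longleftrightarrow> D * M = M * D"
proof -
  have D: "D \<in> carrier_mat n n" by (simp add: D_def)
  have DM: "(D * M) $$ (i, j) = real (c i mod h) * M $$ (i, j)" if "i < n" "j < n" for i j
  proof -
    have "(D * M) $$ (i, j) = (\<Sum>k<n. if k = i then real (c i mod h) * M $$ (i, j) else 0)"
      unfolding index_mult_mat_sum[OF D M that] using that by (intro sum.cong) (auto simp: D_def)
    then show ?thesis using that by simp
  qed
  have MD: "(M * D) $$ (i, j) = M $$ (i, j) * real (c j mod h)" if "i < n" "j < n" for i j
  proof -
    have "(M * D) $$ (i, j) = (\<Sum>k<n. if k = j then M $$ (i, j) * real (c j mod h) else 0)"
      unfolding index_mult_mat_sum[OF M D that] using that by (intro sum.cong) (auto simp: D_def)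
    then show ?thesis using that by simp
  qed
  have "D * M = M * D \<longleftrightarrow> (\<forall>i<n. \<forall>j<n. (D * M) $$ (i, j) = (M * D) $$ (i, j))"
    using D M
    by (auto simp: mat_eq_iff simp del: index_mult_mat(1))
  also have "\<dots> \<longleftrightarrow> (\<forall>i<n. \<forall>j<n. M $$ (i, j) \<noteq> 0 \<longrightarrow> c i mod h = c j mod h)"
    by (auto simp: DM MD simp del: index_mult_mat(1))
  also have "\<dots> \<longleftrightarrow> homogeneous h c 0 M"
    using M by (auto simp: homogeneous_def cong_def)
  finally show ?thesis ..
qed

lemma homogeneous_0_of_bicommutant:
  fixes B F :: "real mat"
  assumes B: "B \<in> carrier_mat n n" and F: "F \<in> carrier_mat n n" and hB: "homogeneous h c 0 B"
    and comm: "\<And>M. M \<in> carrier_mat n n \<Longrightarrow> M * B = B * M \<Longrightarrow> M * F = F * M"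
  shows "homogeneous h c 0 F"
  using hB unfolding homogeneous_0_iff_commute[OF B] homogeneous_0_iff_commute[OF F]
  by (intro comm) simp_all

lemma pow_mat_add_orthogonal:
  fixes U V :: "real mat"
  assumes U: "U \<in> carrier_mat n n" and V: "V \<in> carrier_mat n n"
    and UV: "U * V = 0\<^sub>m n n" and VU: "V * U = 0\<^sub>m n n"
  shows "(U + V) ^\<^sub>m Suc k = U ^\<^sub>m Suc k + V ^\<^sub>m Suc k"
proof (induction k)
  case 0
  then show ?case using U V by simp
next
  case (Suc k)
  have Uk: "U ^\<^sub>m k \<in> carrier_mat n n" and Vk: "V ^\<^sub>m k \<in> carrier_mat n n"
    using U V by (auto intro: pow_carrier_mat)
  have U': "U ^\<^sub>m Suc k \<in> carrier_mat n n" and V': "V ^\<^sub>m Suc k \<in> carrier_mat n n"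
    using U V by (auto intro: pow_carrier_mat)
  have 1: "U ^\<^sub>m Suc k * V = 0\<^sub>m n n"
    using assoc_mult_mat[OF Uk U V] UV right_mult_zero_mat[OF Uk] by simp
  have 2: "V ^\<^sub>m Suc k * U = 0\<^sub>m n n"
    using assoc_mult_mat[OF Vk V U] VU right_mult_zero_mat[OF Vk] by simp
  have "(U + V) ^\<^sub>m Suc (Suc k) = (U ^\<^sub>m Suc k + V ^\<^sub>m Suc k) * (U + V)"
    using Suc by (simp only: pow_mat.simps(2)[of _ "Suc k"])
  also have "\<dots> = (U ^\<^sub>m Suc k + V ^\<^sub>m Suc k) * U + (U ^\<^sub>m Suc k + V ^\<^sub>m Suc k) * V"
    by (rule mult_add_distrib_mat[OF add_carrier_mat[OF V'] U V])
  also have "(U ^\<^sub>m Suc k + V ^\<^sub>m Suc k) * U = U ^\<^sub>m Suc k * U + V ^\<^sub>m Suc k * U"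
    by (rule add_mult_distrib_mat[OF U' V' U])
  also have "(U ^\<^sub>m Suc k + V ^\<^sub>m Suc k) * V = U ^\<^sub>m Suc k * V + V ^\<^sub>m Suc k * V"
    by (rule add_mult_distrib_mat[OF U' V' V])
  finally show ?case
    unfolding 1 2 pow_mat.simps(2)[of _ "Suc k"]
    using mult_carrier_mat[OF U' U] mult_carrier_mat[OF V' V]
    by (simp only: right_add_zero_mat left_add_zero_mat)
qed

lemma idempotent_pow_mat:
  fixes e :: "real mat"
  assumes e: "e \<in> carrier_mat n n" and ee: "e * e = e"
  shows "e ^\<^sub>m Suc k = e"
  by (induction k) (use e ee in auto)

text \<open>
A root \<open>Y\<^sub>1\<close> of \<open>A\<close> on the range of \<open>e\<close> is completed by \<open>X\<close> on the complement. The complement may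
violate the grading, because \<open>A ^ m\<close> annihilates it.
\<close>

lemma splice_root:
  fixes A X Y\<^sub>1 e :: "real mat"
  assumes X: "X \<in> carrier_mat n n" and XA: "X ^\<^sub>m p = A" and p: "p > 0"
    and e: "e \<in> carrier_mat n n" and ee: "e * e = e" and Xe: "X * e = e * X"
    and Y: "Y\<^sub>1 \<in> carrier_mat n n" and Ye: "Y\<^sub>1 * e = Y\<^sub>1" and eY: "e * Y\<^sub>1 = Y\<^sub>1" and Yp: "Y\<^sub>1 ^\<^sub>m p = A * e"
    and hY: "homogeneous h c r Y\<^sub>1" and hA: "homogeneous h c 1 A" and m: "A ^\<^sub>m m * e = A ^\<^sub>m m"
  shows "\<exists>Y. Y \<in> carrier_mat n n \<and> Y ^\<^sub>m p = A \<and> (\<forall>t\<ge>m. homogeneous h c (t + r) (A ^\<^sub>m t * Y))"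
proof -
  define e' where "e' = 1\<^sub>m n - e"
  have e': "e' \<in> carrier_mat n n" unfolding e'_def by (rule minus_carrier_mat[OF e])
  have A: "A \<in> carrier_mat n n" using X XA by (auto intro: pow_carrier_mat)
  have Me': "M * e' = M - M * e" and e'M: "e' * M = M - e * M" if "M \<in> carrier_mat n n" for M
    using that e mult_minus_distrib_mat[OF that one_carrier_mat e] minus_mult_distrib_mat[OF one_carrier_mat e that]
    by (simp_all add: e'_def)
  have Me: "M * e \<in> carrier_mat n n" if "M \<in> carrier_mat n n" for M
    using that e by (rule mult_carrier_mat)
  have e'e': "e' * e' = e'"
    unfolding Me'[OF e'] using e'M[OF e] e e' ee by (auto intro!: eq_matI)
  define U where "U = X * e'"
  have U: "U \<in> carrier_mat n n" using X e' by (auto simp: U_def intro: mult_carrier_mat)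
  have Xe': "X * e' = e' * X" using Me'[OF X] e'M[OF X] Xe by simp
  have e'Y: "e' * Y\<^sub>1 = 0\<^sub>m n n" using e'M[OF Y] eY Y by simp
  have Ye': "Y\<^sub>1 * e' = 0\<^sub>m n n" using Me'[OF Y] Ye Y by simp
  have UY: "U * Y\<^sub>1 = 0\<^sub>m n n"
    unfolding U_def using assoc_mult_mat[OF X e' Y] e'Y X by simp
  have YU: "Y\<^sub>1 * U = 0\<^sub>m n n"
    unfolding U_def Xe' using assoc_mult_mat[OF Y e' X] Ye' X by simp
  obtain p' where p': "p = Suc p'" using p by (cases p) auto
  have "(U + Y\<^sub>1) ^\<^sub>m p = U ^\<^sub>m p + Y\<^sub>1 ^\<^sub>m p"
    unfolding p' by (rule pow_mat_add_orthogonal[OF U Y UY YU])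
  also have "U ^\<^sub>m p = A * e'"
    unfolding U_def pow_mat_mult_distrib[OF X e' Xe'] XA using idempotent_pow_mat[OF e' e'e'] by (simp only: p')
  also have "A * e' + Y\<^sub>1 ^\<^sub>m p = A"
    unfolding Yp Me'[OF A] using A Me[OF A] by (intro eq_matI) (auto simp del: index_mult_mat(1))
  finally have root: "(U + Y\<^sub>1) ^\<^sub>m p = A" .
  have "homogeneous h c (t + r) (A ^\<^sub>m t * (U + Y\<^sub>1))" if "t \<ge> m" for t
  proof -
    have At: "A ^\<^sub>m t \<in> carrier_mat n n" for t using A by (rule pow_carrier_mat)
    have "A ^\<^sub>m t * e = A ^\<^sub>m (t - m) * (A ^\<^sub>m m * e)"
      using pow_mat_add[OF A, of "t - m" m] assoc_mult_mat[OF At At e] that by simp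
    also have "\<dots> = A ^\<^sub>m t" using pow_mat_add[OF A, of "t - m" m] that unfolding m by simp
    finally have te: "A ^\<^sub>m t * e' = 0\<^sub>m n n" unfolding Me'[OF At] using At by simp
    have "A ^\<^sub>m t * U = 0\<^sub>m n n"
      unfolding U_def Xe' assoc_mult_mat[OF At e' X, symmetric] te by (rule left_mult_zero_mat[OF X])
    then have "A ^\<^sub>m t * (U + Y\<^sub>1) = A ^\<^sub>m t * Y\<^sub>1"
      using mult_add_distrib_mat[OF At U Y] mult_carrier_mat[OF At Y] by (simp only: left_add_zero_mat)
    then show ?thesis
      using homogeneous_mult[OF At Y homogeneous_pow[OF A hA, of t] hY] by simp
  qed
  then show ?thesis using root U Y by (intro exI[of _ "U + Y\<^sub>1"]) auto
qed

text \<open>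
The difference \<open>c j - c i\<close> modulo \<open>h\<close>. Adding a multiple of \<open>h\<close> keeps it a natural number.
\<close>

definition class_diff :: "nat \<Rightarrow> (nat \<Rightarrow> nat) \<Rightarrow> nat \<Rightarrow> nat \<Rightarrow> nat" where
  "class_diff h c i j = c j + (h * c i - c i)"

lemma class_diff_cong:
  assumes "h > 0"
  shows "[c i + class_diff h c i j = c j] (mod h)"
proof -
  have "c i \<le> h * c i" using assms by simp
  then have "c i + class_diff h c i j = c j + h * c i" unfolding class_diff_def by linarith
  then show ?thesis by (simp add: cong_sym_eq[of _ "c j"] cong_add_self_iff)
qed

text \<open>
If \<open>M\<close> is the sum of its components \<open>M\<^sub>a\<close> of degree \<open>a\<close>, this is the sum of the products \<open>M\<^sub>a T\<^sub>a\<close>.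
\<close>

definition twist :: "nat \<Rightarrow> nat \<Rightarrow> (nat \<Rightarrow> nat) \<Rightarrow> (nat \<Rightarrow> real mat) \<Rightarrow> real mat \<Rightarrow> real mat" where
  "twist n h c T M = mat n n (\<lambda>(i, l). \<Sum>j<n. M $$ (i, j) * T (class_diff h c i j) $$ (j, l))"

text \<open>
The matrix \<open>T a\<close> stands for the power \<open>C ^ (- a)\<close> of a cyclic shift \<open>C\<close> of degree one with
\<open>C ^ h = 1\<close>. The unit \<open>T 0\<close> is an idempotent rather than the identity matrix, since \<open>C\<close> lives on the
invertible part of another matrix only.
\<close>

locale graded_shift =
  fixes n h :: nat and c :: "nat \<Rightarrow> nat" and T :: "nat \<Rightarrow> real mat"
  assumes h: "h > 0"
    and T: "T a \<in> carrier_mat n n"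
    and T_mult: "T a * T b = T (a + b)"
    and T_cong: "[a = b] (mod h) \<Longrightarrow> T a = T b"
    and T_degree: "i < n \<Longrightarrow> j < n \<Longrightarrow> T a $$ (i, j) \<noteq> 0 \<Longrightarrow> [c i = c j + a] (mod h)"
begin

abbreviation "\<delta> \<equiv> class_diff h c"
abbreviation "\<tau> \<equiv> twist n h c T"

lemma twist_carrier: "\<tau> M \<in> carrier_mat n n"
  by (simp add: twist_def)

lemma twist_index: "i < n \<Longrightarrow> l < n \<Longrightarrow> \<tau> M $$ (i, l) = (\<Sum>j<n. M $$ (i, j) * T (\<delta> i j) $$ (j, l))"
  by (simp add: twist_def)

lemma class_diff_cong_iff: "[\<delta> i j = a] (mod h) \<longleftrightarrow> [c j = c i + a] (mod h)"
  using class_diff_cong[OF h, of c i j] by (metis cong_add_lcancel_nat cong_sym cong_trans)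

lemma twist_homogeneous: "homogeneous h c 0 (\<tau> M)"
proof (rule homogeneousI[OF twist_carrier])
  fix i l assume il: "i < n" "l < n" and "\<tau> M $$ (i, l) \<noteq> 0"
  then obtain j where "j < n" "M $$ (i, j) * T (\<delta> i j) $$ (j, l) \<noteq> 0"
    by (metis (no_types, lifting) twist_index lessThan_iff sum.neutral)
  then have "[c j = c l + \<delta> i j] (mod h)" using T_degree il by (metis mult_zero_right)
  then have "[c i + \<delta> i j = c l + \<delta> i j] (mod h)"
    using class_diff_cong[OF h, of c i j] by (metis cong_trans)
  then show "[c l = c i + 0] (mod h)" by (simp add: cong_add_rcancel_nat cong_sym_eq)
qed

lemma twist_of_homogeneous:
  assumes M: "M \<in> carrier_mat n n" and hM: "homogeneous h c a M"
  shows "\<tau> M = M * T a"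
proof (rule eq_matI)
  fix i l assume "i < dim_row (M * T a)" "l < dim_col (M * T a)"
  then have il: "i < n" "l < n" using M T[of a] by auto
  have "M $$ (i, j) * T (\<delta> i j) $$ (j, l) = M $$ (i, j) * T a $$ (j, l)" if "j < n" for j
  proof (cases "M $$ (i, j) = 0")
    case False
    then have "[\<delta> i j = a] (mod h)"
      using homogeneousD[OF hM M il(1) that] by (simp add: class_diff_cong_iff)
    then show ?thesis using T_cong by simp
  qed simp
  then show "\<tau> M $$ (i, l) = (M * T a) $$ (i, l)"
    using il by (auto simp: twist_index index_mult_mat_sum[OF M T] simp del: index_mult_mat(1) intro!: sum.cong)
qed (use M T[of a] in \<open>auto simp: twist_def\<close>)

lemma twist_mult_shift:
  assumes N: "N \<in> carrier_mat n n" and il: "i < n" "l < n"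
  shows "(\<tau> N * T b) $$ (i, l) = (\<Sum>j<n. N $$ (i, j) * T (\<delta> i j + b) $$ (j, l))"
proof -
  have "(\<tau> N * T b) $$ (i, l) = (\<Sum>k<n. \<Sum>j<n. N $$ (i, j) * T (\<delta> i j) $$ (j, k) * T b $$ (k, l))"
    using il by (simp add: index_mult_mat_sum[OF twist_carrier T] twist_index sum_distrib_right del: index_mult_mat(1))
  also have "\<dots> = (\<Sum>j<n. \<Sum>k<n. N $$ (i, j) * T (\<delta> i j) $$ (j, k) * T b $$ (k, l))"
    by (rule sum.swap)
  also have "\<dots> = (\<Sum>j<n. N $$ (i, j) * (T (\<delta> i j) * T b) $$ (j, l))"
    using il by (intro sum.cong) (simp_all add: index_mult_mat_sum[OF T T] sum_distrib_left mult.assoc del: index_mult_mat(1))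
  finally show ?thesis by (simp only: T_mult)
qed

text \<open>
A homogeneous matrix that commutes with \<open>N\<close> commutes with every homogeneous component of \<open>N\<close>.
\<close>

lemma shift_mult_twist:
  assumes N: "N \<in> carrier_mat n n" and NT: "N * T b = T b * N"
  shows "T b * \<tau> N = \<tau> N * T b"
proof (rule eq_matI)
  fix i l assume "i < dim_row (\<tau> N * T b)" "l < dim_col (\<tau> N * T b)"
  then have il: "i < n" "l < n" using twist_carrier[of N] T[of b] by auto
  have "(T b * \<tau> N) $$ (i, l) = (\<Sum>j<n. \<Sum>k<n. T b $$ (i, j) * (N $$ (j, k) * T (\<delta> j k) $$ (k, l)))"
    using il by (simp add: index_mult_mat_sum[OF T twist_carrier] twist_index sum_distrib_left del: index_mult_mat(1))
  also have "\<dots> = (\<Sum>j<n. \<Sum>k<n. (T b $$ (i, j) * N $$ (j, k)) * T (\<delta> i k + b) $$ (k, l))"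
  proof (intro sum.cong refl)
    fix j k assume "j \<in> {..<n}" "k \<in> {..<n}"
    show "T b $$ (i, j) * (N $$ (j, k) * T (\<delta> j k) $$ (k, l)) = (T b $$ (i, j) * N $$ (j, k)) * T (\<delta> i k + b) $$ (k, l)"
    proof (cases "T b $$ (i, j) = 0")
      case False
      then have "[c i = c j + b] (mod h)" using T_degree il \<open>j \<in> {..<n}\<close> by simp
      then have "[c i + \<delta> i k = c j + (\<delta> i k + b)] (mod h)"
        using cong_add[OF _ cong_refl, of "c i" "c j + b" h "\<delta> i k"] by (simp add: ac_simps)
      then have "[\<delta> j k = \<delta> i k + b] (mod h)"
        using class_diff_cong[OF h, of c i k] unfolding class_diff_cong_iff by (metis cong_sym cong_trans)
      then show ?thesis using T_cong by (simp add: mult.assoc)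
    qed simp
  qed
  also have "\<dots> = (\<Sum>k<n. \<Sum>j<n. (T b $$ (i, j) * N $$ (j, k)) * T (\<delta> i k + b) $$ (k, l))"
    by (rule sum.swap)
  also have "\<dots> = (\<Sum>k<n. (T b * N) $$ (i, k) * T (\<delta> i k + b) $$ (k, l))"
    using il by (intro sum.cong) (simp_all add: index_mult_mat_sum[OF T N] sum_distrib_right del: index_mult_mat(1))
  also have "\<dots> = (\<Sum>k<n. (N * T b) $$ (i, k) * T (\<delta> i k + b) $$ (k, l))" by (simp only: NT)
  also have "\<dots> = (\<Sum>k<n. \<Sum>j<n. N $$ (i, j) * T b $$ (j, k) * T (\<delta> i k + b) $$ (k, l))"
    using il by (intro sum.cong) (simp_all add: index_mult_mat_sum[OF N T] sum_distrib_right del: index_mult_mat(1))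
  also have "\<dots> = (\<Sum>k<n. \<Sum>j<n. N $$ (i, j) * (T b $$ (j, k) * T (\<delta> i j) $$ (k, l)))"
  proof (intro sum.cong refl)
    fix k j assume "j \<in> {..<n}" "k \<in> {..<n}"
    show "N $$ (i, j) * T b $$ (j, k) * T (\<delta> i k + b) $$ (k, l) = N $$ (i, j) * (T b $$ (j, k) * T (\<delta> i j) $$ (k, l))"
    proof (cases "T b $$ (j, k) = 0")
      case False
      then have "[c j = c k + b] (mod h)" using T_degree \<open>k \<in> {..<n}\<close> \<open>j \<in> {..<n}\<close> by simp
      moreover have "[c k + b = c i + \<delta> i k + b] (mod h)"
        using class_diff_cong[OF h, of c i k] by (simp add: cong_add_rcancel_nat cong_sym_eq)
      ultimately have "[\<delta> i j = \<delta> i k + b] (mod h)"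
        unfolding class_diff_cong_iff by (metis add.assoc cong_trans)
      then show ?thesis using T_cong by (simp add: mult.assoc)
    qed simp
  qed
  also have "\<dots> = (\<Sum>j<n. \<Sum>k<n. N $$ (i, j) * (T b $$ (j, k) * T (\<delta> i j) $$ (k, l)))"
    by (rule sum.swap)
  also have "\<dots> = (\<Sum>j<n. N $$ (i, j) * (T b * T (\<delta> i j)) $$ (j, l))"
    using il by (intro sum.cong) (simp_all add: index_mult_mat_sum[OF T T] sum_distrib_left del: index_mult_mat(1))
  also have "\<dots> = (\<tau> N * T b) $$ (i, l)"
    unfolding T_mult twist_mult_shift[OF N il] by (simp only: add.commute)
  finally show "(T b * \<tau> N) $$ (i, l) = (\<tau> N * T b) $$ (i, l)" .
qed (use twist_carrier[of N] T[of b] in auto)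

text \<open>
Since the shifts commute with the components of \<open>N\<close>, one has
\<open>M\<^sub>a T\<^sub>a N\<^sub>b T\<^sub>b = M\<^sub>a N\<^sub>b T\<^sub>a\<^sub>+\<^sub>b\<close>, so twisting is multiplicative and sends roots to roots.
\<close>

lemma twist_mult:
  assumes M: "M \<in> carrier_mat n n" and N: "N \<in> carrier_mat n n" and NT: "\<And>b. N * T b = T b * N"
  shows "\<tau> M * \<tau> N = \<tau> (M * N)"
proof (rule eq_matI)
  fix i l assume "i < dim_row (\<tau> (M * N))" "l < dim_col (\<tau> (M * N))"
  then have il: "i < n" "l < n" using twist_carrier[of "M * N"] by auto
  have "(\<tau> M * \<tau> N) $$ (i, l) = (\<Sum>k<n. \<Sum>j<n. M $$ (i, j) * T (\<delta> i j) $$ (j, k) * \<tau> N $$ (k, l))"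
    using il by (simp add: index_mult_mat_sum[OF twist_carrier twist_carrier] twist_index[of i] sum_distrib_right del: index_mult_mat(1))
  also have "\<dots> = (\<Sum>j<n. \<Sum>k<n. M $$ (i, j) * T (\<delta> i j) $$ (j, k) * \<tau> N $$ (k, l))"
    by (rule sum.swap)
  also have "\<dots> = (\<Sum>j<n. M $$ (i, j) * (T (\<delta> i j) * \<tau> N) $$ (j, l))"
    using il by (intro sum.cong) (simp_all add: index_mult_mat_sum[OF T twist_carrier] sum_distrib_left mult.assoc del: index_mult_mat(1))
  also have "\<dots> = (\<Sum>j<n. \<Sum>k<n. M $$ (i, j) * (N $$ (j, k) * T (\<delta> j k + \<delta> i j) $$ (k, l)))"
    unfolding shift_mult_twist[OF N NT]
    using il by (intro sum.cong) (simp_all add: twist_mult_shift[OF N] sum_distrib_left del: index_mult_mat(1))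
  also have "\<dots> = (\<Sum>j<n. \<Sum>k<n. M $$ (i, j) * N $$ (j, k) * T (\<delta> i k) $$ (k, l))"
  proof (intro sum.cong refl)
    fix j k
    have "[c i + (\<delta> i j + \<delta> j k) = c k] (mod h)"
      using class_diff_cong[OF h, of c i j] class_diff_cong[OF h, of c j k]
      by (metis add.assoc cong_add_rcancel_nat cong_trans)
    then have "[\<delta> i k = \<delta> j k + \<delta> i j] (mod h)"
      unfolding class_diff_cong_iff by (simp add: add.commute cong_sym_eq)
    then show "M $$ (i, j) * (N $$ (j, k) * T (\<delta> j k + \<delta> i j) $$ (k, l)) = M $$ (i, j) * N $$ (j, k) * T (\<delta> i k) $$ (k, l)"
      using T_cong by (simp add: mult.assoc)
  qed
  also have "\<dots> = (\<Sum>k<n. \<Sum>j<n. M $$ (i, j) * N $$ (j, k) * T (\<delta> i k) $$ (k, l))"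
    by (rule sum.swap)
  also have "\<dots> = \<tau> (M * N) $$ (i, l)"
    using il by (simp add: twist_index index_mult_mat_sum[OF M N] sum_distrib_right del: index_mult_mat(1))
  finally show "(\<tau> M * \<tau> N) $$ (i, l) = \<tau> (M * N) $$ (i, l)" .
qed (simp_all add: twist_def)

lemma twist_pow:
  assumes M: "M \<in> carrier_mat n n" and MT: "\<And>b. M * T b = T b * M"
  shows "\<tau> M ^\<^sub>m Suc k = \<tau> (M ^\<^sub>m Suc k)"
proof (induction k)
  case 0
  then show ?case using M twist_carrier[of M] by simp
next
  case (Suc k)
  then show ?case
    using twist_mult[OF pow_carrier_mat[OF M] M MT, of "Suc k"] by (simp only: pow_mat.simps(2)[of _ "Suc k"])
qed

lemma shift_pow: "T a ^\<^sub>m Suc k = T (a * Suc k)"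
proof (induction k)
  case 0
  then show ?case using T[of a] by simp
next
  case (Suc k)
  then show ?case by (simp only: pow_mat.simps(2)[of _ "Suc k"] T_mult) (simp add: algebra_simps)
qed

end

text \<open>
The exponent \<open>r\<close> is forced: a root of degree \<open>r\<close> has a \<open>p\<close>-th power of degree \<open>r p\<close>, and \<open>A\<close> has
degree one. The inverse of \<open>B = A ^ h\<close> is the right matrix to take roots of, because it has degree
zero, and its roots that are polynomials in \<open>B\<close> inherit this. For odd \<open>p\<close> it has such a \<open>p\<close>-th root.
For even \<open>p\<close> it may have no root of this kind, because of negative eigenvalues; then \<open>X\<close> itself has to be used, and
the \<open>h\<close>-th root of the inverse of \<open>B\<close>, which exists because \<open>h\<close> is odd, serves to twist \<open>X\<close> into degree zero.
\<close>

lemma homogeneous_root: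
  fixes A X :: "real mat"
  assumes X: "X \<in> carrier_mat n n" and XA: "X ^\<^sub>m p = A" and p: "p > 0"
    and h: "h > 0" and cop: "coprime h p" and hA: "homogeneous h c 1 A"
  obtains Y r t\<^sub>0 where "Y \<in> carrier_mat n n" "Y ^\<^sub>m p = A" "[r * p = 1] (mod h)"
    "\<And>t. t \<ge> t\<^sub>0 \<Longrightarrow> homogeneous h c (t + r) (A ^\<^sub>m t * Y)"
proof -
  have A: "A \<in> carrier_mat n n" using X XA by (auto intro: pow_carrier_mat)
  note [simp] = assoc_mult_mat[of _ n n _ n _ n] mult_carrier_mat[of _ n n _ n] pow_carrier_mat[of _ n]
  obtain r\<^sub>0 where "[p * r\<^sub>0 = 1] (mod h)"
    using cong_solve_coprime_nat[of p h] cop by (auto simp: coprime_commute)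
  \<comment> \<open>A positive \<open>r\<close> ensures that \<open>p * r - 1\<close> is a natural multiple of \<open>h\<close> even for \<open>h = 1\<close>.\<close>
  then have "[p * (r\<^sub>0 + h) = 1] (mod h)"
    by (simp add: cong_def algebra_simps)
  then obtain r where r: "[p * r = 1] (mod h)" and "r > 0" using h by (meson trans_less_add2)
  moreover have "1 \<le> p * r" using p \<open>r > 0\<close> by (simp add: Suc_le_eq)
  ultimately obtain k where k: "p * r = k * h + 1" using cong_le_nat[of 1 "p * r" h] by auto
  define B where "B = A ^\<^sub>m h"
  have B: "B \<in> carrier_mat n n" using A by (simp add: B_def pow_carrier_mat)
  have hB: "homogeneous h c 0 B"
    unfolding B_def by (rule homogeneous_cong[OF homogeneous_pow[OF A hA]]) (simp add: cong_def)
  have comB: "M * B = B * M" if "M \<in> carrier_mat n n" "A * M = M * A" for M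
    unfolding B_def using pow_mat_commute[OF A that] by simp
  have XB: "X * B = B * X"
    using pow_mat_commute[OF X X refl, of p] XA X by (intro comB) auto
  define q where "q = (if odd p then p else h)"
  have "odd q" using cop p by (auto simp: q_def coprime_def)
  obtain e F m where e: "e \<in> carrier_mat n n" and F: "F \<in> carrier_mat n n"
    and comm: "\<And>M. M \<in> carrier_mat n n \<Longrightarrow> M * B = B * M \<Longrightarrow> M * e = e * M \<and> M * F = F * M"
    and ee: "e * e = e" and Fe: "F * e = F" and BF: "B * F ^\<^sub>m q = e" and Bm: "B ^\<^sub>m m * e = B ^\<^sub>m m"
    using odd_root_on_invertible_part[OF B \<open>odd q\<close>] by metis
  have he: "homogeneous h c 0 e" and hF: "homogeneous h c 0 F"
    by (rule homogeneous_0_of_bicommutant[OF B _ hB]; use e F comm in blast)+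
  have Ae: "A * e = e * A" and AF: "A * F = F * A" using comm[OF A comB[OF A refl]] by auto
  have Xe: "X * e = e * X" and XF: "X * F = F * X" using comm[OF X XB] by auto
  have BFc: "B * F = F * B" using comm[OF B refl] by auto
  have eF: "e * F = F * e" using comm[OF F BFc[symmetric]] by auto
  have Am: "A ^\<^sub>m (h * m) * e = A ^\<^sub>m (h * m)" using Bm pow_mat_mult[OF A, of h m] by (simp add: B_def)
  have "\<exists>Y\<^sub>1. Y\<^sub>1 \<in> carrier_mat n n \<and> Y\<^sub>1 * e = Y\<^sub>1 \<and> e * Y\<^sub>1 = Y\<^sub>1 \<and> Y\<^sub>1 ^\<^sub>m p = A * e \<and> homogeneous h c r Y\<^sub>1"
  proof (cases "odd p")
    case True
    then have qp: "q = p" by (simp add: q_def)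
    \<comment> \<open>The factor \<open>e\<close> only matters for \<open>k = 0\<close>, where \<open>F ^ k\<close> is the full identity matrix.\<close>
    define G where "G = F ^\<^sub>m k * e"
    have G: "G \<in> carrier_mat n n" using F e by (simp add: G_def)
    have Fk: "F ^\<^sub>m k \<in> carrier_mat n n" and Ar: "A ^\<^sub>m r \<in> carrier_mat n n"
      using F A by simp_all
    have eFk: "e * F ^\<^sub>m k = F ^\<^sub>m k * e" using pow_mat_commute[OF F e eF[symmetric]] by simp
    have AG: "A * G = G * A"
    proof -
      have "A * G = (A * F ^\<^sub>m k) * e" using A Fk e by (simp add: G_def)
      also have "A * F ^\<^sub>m k = F ^\<^sub>m k * A" using pow_mat_commute[OF F A AF[symmetric]] by simp
      also have "(F ^\<^sub>m k * A) * e = F ^\<^sub>m k * (A * e)" using A Fk e by simp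
      also have "\<dots> = G * A" using A Fk e Ae by (simp add: G_def)
      finally show ?thesis .
    qed
    have ArG: "A ^\<^sub>m r * G = G * A ^\<^sub>m r" by (rule pow_mat_commute[OF A G AG])
    have Ge: "G * e = G" using Fk e ee by (simp add: G_def)
    have eG: "e * G = G"
    proof -
      have "e * G = (e * F ^\<^sub>m k) * e" using Fk e by (simp add: G_def)
      then show ?thesis using Fk e ee unfolding eFk by (simp add: G_def)
    qed
    obtain p' where p': "p = Suc p'" using p by (cases p) auto
    have BGp: "B ^\<^sub>m k * G ^\<^sub>m p = e"
    proof -
      have "G ^\<^sub>m p = (F ^\<^sub>m k) ^\<^sub>m p * e ^\<^sub>m p"
        unfolding G_def by (rule pow_mat_mult_distrib[OF Fk e eFk[symmetric]])
      also have "e ^\<^sub>m p = e" unfolding p' by (rule idempotent_pow_mat[OF e ee])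
      also have "(F ^\<^sub>m k) ^\<^sub>m p = (F ^\<^sub>m p) ^\<^sub>m k"
        using pow_mat_mult[OF F, of k p] pow_mat_mult[OF F, of p k] by (simp add: mult.commute)
      finally have "B ^\<^sub>m k * G ^\<^sub>m p = (B ^\<^sub>m k * (F ^\<^sub>m p) ^\<^sub>m k) * e"
        using B F e by simp
      also have "B ^\<^sub>m k * (F ^\<^sub>m p) ^\<^sub>m k = (B * F ^\<^sub>m p) ^\<^sub>m k"
        using F pow_mat_commute[OF F B BFc[symmetric], of p] by (intro pow_mat_mult_distrib[OF B, symmetric]) simp_all
      also have "B * F ^\<^sub>m p = e" using BF qp by simp
      also have "e ^\<^sub>m k * e = e" using idempotent_pow_mat[OF e ee, of k] by simp
      finally show ?thesis .
    qed
    have "(A ^\<^sub>m r * G) ^\<^sub>m p = (A ^\<^sub>m r) ^\<^sub>m p * G ^\<^sub>m p"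
      by (rule pow_mat_mult_distrib[OF Ar G ArG])
    also have "(A ^\<^sub>m r) ^\<^sub>m p = A * B ^\<^sub>m k"
    proof -
      have "(A ^\<^sub>m r) ^\<^sub>m p = A ^\<^sub>m (1 + h * k)"
        using pow_mat_mult[OF A, of r p] k by (simp add: mult.commute)
      then show ?thesis using pow_mat_add[OF A, of 1 "h * k"] pow_mat_mult[OF A, of h k] A by (simp add: B_def)
    qed
    also have "A * B ^\<^sub>m k * G ^\<^sub>m p = A * (B ^\<^sub>m k * G ^\<^sub>m p)" using A B G by simp
    finally have "(A ^\<^sub>m r * G) ^\<^sub>m p = A * e" unfolding BGp .
    moreover have "A ^\<^sub>m r * G * e = A ^\<^sub>m r * G" using Ar G e Ge by simp
    moreover have "e * (A ^\<^sub>m r * G) = A ^\<^sub>m r * G"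
      using assoc_mult_mat[OF e G Ar] eG unfolding ArG by simp
    moreover have "homogeneous h c r (A ^\<^sub>m r * G)"
      using homogeneous_mult[OF Ar G homogeneous_pow[OF A hA, of r]
          homogeneous_mult[OF Fk e homogeneous_pow[OF F hF] he, folded G_def]] by simp
    ultimately show ?thesis using Ar G by (intro exI[of _ "A ^\<^sub>m r * G"]) simp
  next
    case False
    then have qh: "q = h" by (simp add: q_def)
    define C where "C = A * F"
    have C: "C \<in> carrier_mat n n" using A F by (simp add: C_def)
    have Ch: "C ^\<^sub>m h = e"
      unfolding C_def pow_mat_mult_distrib[OF A F AF] using BF by (simp add: qh B_def)
    have hC: "homogeneous h c 1 C" using homogeneous_mult[OF A F hA hF] by (simp add: C_def)
    have MC: "M * C = C * M" if "M \<in> carrier_mat n n" "M * A = A * M" "M * F = F * M" for M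
    proof -
      have "M * C = (M * A) * F" unfolding C_def by (rule assoc_mult_mat[OF that(1) A F, symmetric])
      also have "\<dots> = A * (M * F)" unfolding that(2) by (rule assoc_mult_mat[OF A that(1) F])
      also have "\<dots> = C * M" using that A F by (simp add: C_def)
      finally show ?thesis .
    qed
    \<comment> \<open>On the range of \<open>e\<close>, \<open>K\<close> is the inverse of \<open>C\<close>.\<close>
    define K where "K = C ^\<^sub>m (h - 1)"
    have K: "K \<in> carrier_mat n n" using C by (simp add: K_def)
    have eK: "e * K ^\<^sub>m a = K ^\<^sub>m a * e" for a
      unfolding K_def pow_mat_mult[OF C, symmetric]
      using pow_mat_commute[OF C e MC[OF e Ae[symmetric] eF, symmetric]] by simp
    have e_pow: "e * e ^\<^sub>m a = e" for a
      using idempotent_pow_mat[OF e ee, of a] pow_mat_add[OF e, of 1 a] e by simp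
    define T where "T a = e * K ^\<^sub>m a" for a
    have T: "T a \<in> carrier_mat n n" for a using e K by (simp add: T_def)
    have hT: "homogeneous h c ((h - 1) * a) (T a)" for a
      using homogeneous_mult[OF e pow_carrier_mat[OF K] he homogeneous_pow[OF K
          homogeneous_pow[OF C hC, of "h - 1", folded K_def]], of a] by (simp add: T_def)
    have T_mult: "T a * T b = T (a + b)" for a b
    proof -
      have "T a * T b = e * (K ^\<^sub>m a * e) * K ^\<^sub>m b" using e K by (simp add: T_def)
      also have "\<dots> = (e * e) * (K ^\<^sub>m a * K ^\<^sub>m b)" unfolding eK[symmetric] using e K by simp
      also have "\<dots> = T (a + b)" using pow_mat_add[OF K] ee by (simp add: T_def)
      finally show ?thesis .
    qed
    have T_period: "T (a + h * k) = T a" for a k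
    proof -
      have "K ^\<^sub>m (h * k) = e ^\<^sub>m ((h - 1) * k)"
        unfolding K_def Ch[symmetric] pow_mat_mult[OF C, symmetric] by (simp add: ac_simps)
      then have "T (h * k) = T 0" using e_pow e K by (simp add: T_def)
      then show ?thesis using T_mult[of a "h * k"] T_mult[of a 0] by simp
    qed
    have T_cong: "T a = T b" if "[a = b] (mod h)" for a b
      using T_period[of "a mod h" "a div h"] T_period[of "b mod h" "b div h"] that by (simp add: cong_def)
    interpret graded_shift n h c T
    proof
      fix a i j assume "i < n" "j < n" "T a $$ (i, j) \<noteq> 0"
      then have "[c j + a = c i + (h - 1) * a + a] (mod h)"
        using homogeneousD[OF hT T] by (simp add: cong_add_rcancel_nat)
      also have "c i + (h - 1) * a + a = c i + h * a" using h by (cases h) simp_all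
      finally show "[c i = c j + a] (mod h)"
        by (metis cong_add_self_iff cong_sym cong_trans dvd_triv_left)
    qed (use h T T_mult T_cong in auto)
    have T0: "T 0 = e" using e K by (simp add: T_def)
    have XC: "X * C = C * X" using MC[OF X _ XF] pow_mat_commute[OF X X refl, of p] XA by simp
    have XT: "X * T b = T b * X" for b
    proof -
      have Kb: "K ^\<^sub>m b \<in> carrier_mat n n" using K by simp
      have "X * T b = (X * e) * K ^\<^sub>m b"
        unfolding T_def by (rule assoc_mult_mat[OF X e Kb, symmetric])
      also have "\<dots> = e * (X * K ^\<^sub>m b)" unfolding Xe by (rule assoc_mult_mat[OF e X Kb])
      also have "X * K ^\<^sub>m b = K ^\<^sub>m b * X"
        unfolding K_def pow_mat_mult[OF C, symmetric] using pow_mat_commute[OF C X XC[symmetric]] by simp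
      finally show ?thesis using e K X by (simp add: T_def)
    qed
    \<comment> \<open>\<open>T s\<close> plays the part of \<open>C ^ r\<close>, as \<open>s\<close> is \<open>- r\<close> modulo \<open>h\<close>.\<close>
    define s where "s = (h - 1) * r"
    obtain p' where p': "p = Suc p'" using p by (cases p) auto
    note \<tau>X = twist_carrier[of X]
    have "(\<tau> X * T s) ^\<^sub>m p = \<tau> X ^\<^sub>m p * T s ^\<^sub>m p"
      using shift_mult_twist[OF X XT] by (intro pow_mat_mult_distrib[OF \<tau>X T]) simp
    also have "\<tau> X ^\<^sub>m p = A * T 1"
      unfolding p' twist_pow[OF X XT] unfolding p'[symmetric] XA by (rule twist_of_homogeneous[OF A hA])
    also have "T s ^\<^sub>m p = T (s * p)" unfolding p' by (rule shift_pow)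
    also have "A * T 1 * T (s * p) = A * T (1 + s * p)" using assoc_mult_mat[OF A T T] T_mult by simp
    also have "T (1 + s * p) = e"
    proof -
      have "1 + s * p = h * (1 + (h - 1) * k)"
      proof -
        have "s * p = (h - 1) * (k * h + 1)" unfolding s_def k[symmetric] by (simp add: ac_simps)
        then show ?thesis using h by (cases h) (simp_all add: algebra_simps)
      qed
      then show ?thesis using T_period[of 0 "1 + (h - 1) * k"] T0 by simp
    qed
    finally have "(\<tau> X * T s) ^\<^sub>m p = A * e" .
    moreover have "\<tau> X * T s * e = \<tau> X * T s"
      unfolding T0[symmetric] using assoc_mult_mat[OF \<tau>X T T] T_mult by simp
    moreover have "e * (\<tau> X * T s) = \<tau> X * T s"
    proof -
      have "e * (\<tau> X * T s) = (T 0 * \<tau> X) * T s" using assoc_mult_mat[OF e \<tau>X T] T0 by simp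
      also have "\<dots> = \<tau> X * (T 0 * T s)" unfolding shift_mult_twist[OF X XT] by (rule assoc_mult_mat[OF \<tau>X T T])
      finally show ?thesis using T_mult by simp
    qed
    moreover have "homogeneous h c r (\<tau> X * T s)"
    proof (rule homogeneous_cong)
      show "homogeneous h c (0 + (h - 1) * s) (\<tau> X * T s)"
        by (rule homogeneous_mult[OF \<tau>X T twist_homogeneous hT])
      have "(h - 1) * s + s = h * s" "r + s = h * r" using h by (cases h; simp add: s_def)+
      then have "[0 + (h - 1) * s + s = r + s] (mod h)" by (simp add: cong_def)
      then show "[0 + (h - 1) * s = r] (mod h)" by (simp only: cong_add_rcancel_nat)
    qed
    moreover have "\<tau> X * T s \<in> carrier_mat n n" by (rule mult_carrier_mat[OF \<tau>X T])
    ultimately show ?thesis by blast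
  qed
  then obtain Y\<^sub>1 where Y: "Y\<^sub>1 \<in> carrier_mat n n" "Y\<^sub>1 * e = Y\<^sub>1" "e * Y\<^sub>1 = Y\<^sub>1" "Y\<^sub>1 ^\<^sub>m p = A * e" "homogeneous h c r Y\<^sub>1"
    by blast
  show ?thesis
    using splice_root[OF X XA p e ee Xe Y hA Am] r that by (metis mult.commute)
qed

section \<open>Perron vectors and mixing\<close>

text \<open>
The complex matrix \<open>(1 / s) A\<close> has spectral radius less than one, so its powers are bounded.
\<close>

lemma pow_mat_le_of_spectral_radius_less:
  fixes A :: "real mat"
  assumes A: "A \<in> carrier_mat n n" and n: "n > 0" and nn: "nonneg_matrix A"
    and s: "spectral_radius (map_mat complex_of_real A) < s"
  shows "\<exists>b. \<forall>k. \<forall>i<n. \<forall>j<n. (A ^\<^sub>m k) $$ (i, j) \<le> b * s ^ k"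
proof -
  define C where "C = map_mat complex_of_real A"
  have C: "C \<in> carrier_mat n n" using A by (simp add: C_def)
  have "0 \<le> spectral_radius C"
    using spectral_radius_mem_max(1)[OF C n] by auto
  then have s0: "s > 0" using s by (simp add: C_def)
  define B where "B = complex_of_real (1 / s) \<cdot>\<^sub>m C"
  have B: "B \<in> carrier_mat n n" using C by (simp add: B_def)
  have "spectral_radius B < 1"
  proof -
    obtain \<beta> where \<beta>: "\<beta> \<in> spectrum B" "spectral_radius B = norm \<beta>"
      using spectral_radius_mem_max(1)[OF B n] by auto
    then obtain x where x: "x \<in> carrier_vec n" "x \<noteq> 0\<^sub>v n" "B *\<^sub>v x = \<beta> \<cdot>\<^sub>v x"
      using B by (auto simp: spectrum_def eigenvalue_def eigenvector_def)
    have "C *\<^sub>v x = (complex_of_real s * \<beta>) \<cdot>\<^sub>v x"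
    proof -
      have "C = complex_of_real s \<cdot>\<^sub>m B" using s0 C by (intro eq_matI) (auto simp: B_def)
      then have "C *\<^sub>v x = complex_of_real s \<cdot>\<^sub>v (B *\<^sub>v x)"
        using B x(1) by (auto intro!: eq_vecI)
      then show ?thesis by (simp add: x(3) smult_smult_assoc)
    qed
    then have "complex_of_real s * \<beta> \<in> spectrum C"
      using C x by (auto simp: spectrum_def eigenvalue_def eigenvector_def)
    then have "norm (complex_of_real s * \<beta>) \<le> spectral_radius C"
      by (intro spectral_radius_mem_max(2)[OF C n]) simp
    then have "s * norm \<beta> \<le> spectral_radius C" using s0 by (simp add: norm_mult)
    then have "s * norm \<beta> < s * 1" using s unfolding C_def by linarith
    then have "norm \<beta> < 1" using s0 by (simp only: mult_less_cancel_left_pos)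
    then show ?thesis using \<beta>(2) by simp
  qed
  then obtain b where b: "\<And>k. norm_bound (B ^\<^sub>m k) b"
    using spectral_radius_jnf_norm_bound_less_1_upper_triangular[OF B] by blast
  have "(A ^\<^sub>m k) $$ (i, j) \<le> b * s ^ k" if "i < n" "j < n" for k i j
  proof -
    have "B ^\<^sub>m k = complex_of_real (1 / s) ^ k \<cdot>\<^sub>m map_mat complex_of_real (A ^\<^sub>m k)"
      unfolding B_def smult_pow_mat[OF C] unfolding C_def by (simp only: of_real_hom.mat_hom_pow[OF A])
    moreover have "norm ((B ^\<^sub>m k) $$ (i, j)) \<le> b"
      using b[of k] that B by (auto simp: norm_bound_def)
    ultimately have "\<bar>(A ^\<^sub>m k) $$ (i, j)\<bar> / s ^ k \<le> b"
      using that A s0 by (simp add: norm_mult norm_power power_divide norm_divide)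
    moreover have "(A ^\<^sub>m k) $$ (i, j) / s ^ k \<le> \<bar>(A ^\<^sub>m k) $$ (i, j)\<bar> / s ^ k"
      using s0 by (intro divide_right_mono) auto
    ultimately have "(A ^\<^sub>m k) $$ (i, j) / s ^ k \<le> b" by linarith
    then show ?thesis using s0 by (simp add: pos_divide_le_eq)
  qed
  then show ?thesis by blast
qed

text \<open>
For an eigenvector \<open>x\<close> of an eigenvalue of maximal modulus \<open>\<rho>\<close>, the moduli \<open>u\<close> of its entries satisfy
\<open>\<rho> u \<le> A u\<close> by the triangle inequality. If this were strict somewhere, then applying a positive
matrix \<open>T\<close> that commutes with \<open>A\<close> would make it strict everywhere: \<open>(\<rho> + \<epsilon>) y \<le> A y\<close> for \<open>y = T u\<close>,
so the powers of \<open>A\<close> would grow faster than the spectral radius \<open>\<rho>\<close> permits. The vector \<open>u\<close> is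
positive because \<open>T u\<close> is a multiple of it.
\<close>

lemma perron_eigenvector:
  fixes A :: "real mat"
  assumes A: "A \<in> carrier_mat n n" and nn: "nonneg_matrix A" and irr: "irreducible_matrix A"
    and nz: "A \<noteq> 0\<^sub>m n n"
  obtains \<rho> v where "\<rho> > 0" "\<And>i. i < n \<Longrightarrow> v i > 0"
    "\<And>i. i < n \<Longrightarrow> (\<Sum>j<n. A $$ (i, j) * v j) = \<rho> * v i"
proof -
  have n0: "n > 0" using irreducible_dim_pos[OF A irr] .
  have A0: "A $$ (i, j) \<ge> 0" if "i < n" "j < n" for i j
    using nn A that by (simp add: nonneg_matrix_iff)
  have Ak: "A ^\<^sub>m k \<in> carrier_mat n n" for k using A by (rule pow_carrier_mat)
  have Ak0: "(A ^\<^sub>m k) $$ (i, j) \<ge> 0" if "i < n" "j < n" for i j k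
    using nonneg_matrix_pow[OF A nn, of k] that unfolding nonneg_matrix_iff[OF Ak] by blast
  define m where "m i j = (SOME m. (A ^\<^sub>m m) $$ (i, j) > 0)" for i j
  have m: "(A ^\<^sub>m m i j) $$ (i, j) > 0" if "i < n" "j < n" for i j
    unfolding m_def using irreducible_pow_entry_pos[OF A nn irr that] by (rule someI_ex)
  define N where "N = Suc (\<Sum>i<n. \<Sum>j<n. m i j)"
  have mN: "m i j < N" if "i < n" "j < n" for i j
  proof -
    have "m i j \<le> (\<Sum>j<n. m i j)" using that by (intro member_le_sum) auto
    also have "\<dots> \<le> (\<Sum>i<n. \<Sum>j<n. m i j)"
      using that by (intro member_le_sum[of i "{..<n}" "\<lambda>i. \<Sum>j<n. m i j"]) auto
    finally show ?thesis by (simp add: N_def)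
  qed
  \<comment> \<open>A positive matrix that commutes with \<open>A\<close>.\<close>
  define T where "T i j = (\<Sum>k<N. (A ^\<^sub>m k) $$ (i, j))" for i j
  have Tpos: "T i j > 0" if "i < n" "j < n" for i j
    unfolding T_def using m[OF that] mN[OF that] Ak0[OF that]
    by (intro sum_pos2[of _ "m i j"]) auto
  have AT: "(\<Sum>j<n. A $$ (i, j) * T j l) = (\<Sum>j<n. T i j * A $$ (j, l))" if "i < n" "l < n" for i l
  proof -
    have "(\<Sum>j<n. A $$ (i, j) * T j l) = (\<Sum>k<N. (A * A ^\<^sub>m k) $$ (i, l))"
      using that by (simp add: T_def sum_distrib_left index_mult_mat_sum[OF A Ak] sum.swap[of _ "{..<N}"] del: index_mult_mat(1))
    also have "\<dots> = (\<Sum>k<N. (A ^\<^sub>m k * A) $$ (i, l))"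
      using pow_mat_commute[OF A A refl] by simp
    also have "\<dots> = (\<Sum>j<n. T i j * A $$ (j, l))"
      using that by (simp add: T_def sum_distrib_right index_mult_mat_sum[OF Ak A] sum.swap[of _ "{..<N}"] del: index_mult_mat(1))
    finally show ?thesis .
  qed
  define C where "C = map_mat complex_of_real A"
  have C: "C \<in> carrier_mat n n" using A by (simp add: C_def)
  define \<rho> where "\<rho> = spectral_radius C"
  obtain l where l: "l \<in> spectrum C" "\<rho> = norm l"
    using spectral_radius_mem_max(1)[OF C n0] by (auto simp: \<rho>_def)
  then obtain x where x: "x \<in> carrier_vec n" "x \<noteq> 0\<^sub>v n" "C *\<^sub>v x = l \<cdot>\<^sub>v x"
    using C by (auto simp: spectrum_def eigenvalue_def eigenvector_def)
  define u where "u i = norm (x $ i)" for i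
  have u0: "u i \<ge> 0" for i by (simp add: u_def)
  obtain i\<^sub>0 where i0: "i\<^sub>0 < n" "u i\<^sub>0 > 0"
    using x(1,2) by (auto simp: u_def vec_eq_iff)
  have sub: "\<rho> * u i \<le> (\<Sum>j<n. A $$ (i, j) * u j)" if i: "i < n" for i
  proof -
    have "l * x $ i = (C *\<^sub>v x) $ i" using x(1) i by (simp add: x(3))
    also have "\<dots> = (\<Sum>j<n. complex_of_real (A $$ (i, j)) * x $ j)"
      using x(1) i A by (auto simp: C_def scalar_prod_def atLeast0LessThan)
    finally have "\<rho> * u i = norm (\<Sum>j<n. complex_of_real (A $$ (i, j)) * x $ j)"
      by (metis l(2) norm_mult u_def)
    also have "\<dots> \<le> (\<Sum>j<n. norm (complex_of_real (A $$ (i, j)) * x $ j))" by (rule norm_sum)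
    also have "\<dots> = (\<Sum>j<n. A $$ (i, j) * u j)"
      using A0 i by (intro sum.cong) (auto simp: norm_mult u_def)
    finally show ?thesis .
  qed
  have \<rho>0: "\<rho> \<ge> 0" by (simp add: l(2))
  have pos: "(\<Sum>j<n. T i j * z j) > 0" if "i < n" "i\<^sub>1 < n" "z i\<^sub>1 > 0" "\<And>j. j < n \<Longrightarrow> z j \<ge> 0" for i i\<^sub>1 z
  proof (rule sum_pos2[of _ i\<^sub>1])
    show "0 < T i i\<^sub>1 * z i\<^sub>1" using that Tpos by simp
    show "0 \<le> T i j * z j" if "j \<in> {..<n}" for j
      using that \<open>\<And>j. j < n \<Longrightarrow> z j \<ge> 0\<close> less_imp_le[OF Tpos[OF \<open>i < n\<close>]] by (intro mult_nonneg_nonneg) auto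
  qed (use that in auto)
  have eig: "(\<Sum>j<n. A $$ (i, j) * u j) = \<rho> * u i" if i: "i < n" for i
  proof (rule ccontr)
    define z where "z i = (\<Sum>j<n. A $$ (i, j) * u j) - \<rho> * u i" for i
    assume "(\<Sum>j<n. A $$ (i, j) * u j) \<noteq> \<rho> * u i"
    then have "z i > 0" using sub[OF i] by (simp add: z_def)
    define y where "y i = (\<Sum>j<n. T i j * u j)" for i
    have y0: "y l > 0" if "l < n" for l unfolding y_def using pos[where z = u, OF that i0] u0 by blast
    define g where "g l = ((\<Sum>j<n. A $$ (l, j) * y j) - \<rho> * y l) / y l" for l
    have g: "g l > 0" if l: "l < n" for l
    proof -
      have "(\<Sum>j<n. A $$ (l, j) * y j) = (\<Sum>j<n. \<Sum>k<n. A $$ (l, j) * (T j k * u k))"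
        by (simp add: y_def sum_distrib_left)
      also have "\<dots> = (\<Sum>k<n. \<Sum>j<n. A $$ (l, j) * (T j k * u k))" by (rule sum.swap)
      also have "\<dots> = (\<Sum>k<n. (\<Sum>j<n. A $$ (l, j) * T j k) * u k)"
        by (simp add: sum_distrib_right mult.assoc)
      also have "\<dots> = (\<Sum>k<n. (\<Sum>j<n. T l j * A $$ (j, k)) * u k)"
        using AT[OF l] by (intro sum.cong) auto
      also have "\<dots> = (\<Sum>j<n. T l j * (\<Sum>k<n. A $$ (j, k) * u k))"
        by (simp add: sum_distrib_left sum_distrib_right mult.assoc) (rule sum.swap)
      finally have "(\<Sum>j<n. A $$ (l, j) * y j) - \<rho> * y l = (\<Sum>j<n. T l j * z j)"
        by (simp add: y_def z_def sum_distrib_left right_diff_distrib sum_subtractf ac_simps)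
      moreover have "(\<Sum>j<n. T l j * z j) > 0"
        using pos[where z = z, OF l i \<open>z i > 0\<close>] sub by (simp add: z_def)
      ultimately show ?thesis using y0[OF l] by (simp add: g_def)
    qed
    define \<epsilon> where "\<epsilon> = Min (g ` {..<n})"
    have "\<epsilon> > 0" unfolding \<epsilon>_def using g n0 by (subst Min_gr_iff) auto
    have "\<epsilon> \<le> g l" if "l < n" for l unfolding \<epsilon>_def using that by (intro Min_le) auto
    then have step: "(\<rho> + \<epsilon>) * y l \<le> (\<Sum>j<n. A $$ (l, j) * y j)" if "l < n" for l
      using y0[OF that] that by (fastforce simp: g_def pos_le_divide_eq algebra_simps)
    have grow: "(\<rho> + \<epsilon>) ^ k * y l \<le> (\<Sum>j<n. (A ^\<^sub>m k) $$ (l, j) * y j)" if "l < n" for k l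
      using that
    proof (induction k arbitrary: l)
      case 0
      have "(\<Sum>j<n. (A ^\<^sub>m 0) $$ (l, j) * y j) = (\<Sum>j<n. if j = l then y l else 0)"
        using A 0 by (intro sum.cong) auto
      then show ?case using 0 by simp
    next
      case (Suc k)
      have "(\<rho> + \<epsilon>) ^ Suc k * y l = (\<rho> + \<epsilon>) ^ k * ((\<rho> + \<epsilon>) * y l)" by simp
      also have "\<dots> \<le> (\<rho> + \<epsilon>) ^ k * (\<Sum>j<n. A $$ (l, j) * y j)"
        using step[OF Suc.prems] \<rho>0 \<open>\<epsilon> > 0\<close> by (intro mult_left_mono) auto
      also have "\<dots> = (\<Sum>j<n. A $$ (l, j) * ((\<rho> + \<epsilon>) ^ k * y j))"
        by (simp add: sum_distrib_left ac_simps)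
      also have "\<dots> \<le> (\<Sum>j<n. A $$ (l, j) * (\<Sum>i<n. (A ^\<^sub>m k) $$ (j, i) * y i))"
        using Suc A0 by (intro sum_mono mult_left_mono) auto
      also have "\<dots> = (\<Sum>i<n. (A * A ^\<^sub>m k) $$ (l, i) * y i)"
        using Suc.prems by (simp add: index_mult_mat_sum[OF A Ak] sum_distrib_left sum_distrib_right mult.assoc del: index_mult_mat(1))
          (rule sum.swap)
      also have "A * A ^\<^sub>m k = A ^\<^sub>m Suc k" using pow_mat_commute[OF A A refl, of k] by simp
      finally show ?case .
    qed
    define s where "s = \<rho> + \<epsilon> / 2"
    have s: "s > 0" "s < \<rho> + \<epsilon>" "\<rho> < s" using \<rho>0 \<open>\<epsilon> > 0\<close> by (auto simp: s_def)
    obtain b where b: "\<And>k i j. i < n \<Longrightarrow> j < n \<Longrightarrow> (A ^\<^sub>m k) $$ (i, j) \<le> b * s ^ k"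
      using pow_mat_le_of_spectral_radius_less[OF A n0 nn, of s] s(3) by (auto simp: \<rho>_def C_def)
    define S where "S = b * (\<Sum>j<n. y j) / y 0"
    have "((\<rho> + \<epsilon>) / s) ^ k \<le> S" for k
    proof -
      have "(\<rho> + \<epsilon>) ^ k * y 0 \<le> (\<Sum>j<n. (A ^\<^sub>m k) $$ (0, j) * y j)" by (rule grow[OF n0])
      also have "\<dots> \<le> (\<Sum>j<n. b * s ^ k * y j)"
        using b n0 y0 by (intro sum_mono mult_right_mono) (auto intro: less_imp_le)
      also have "\<dots> = b * (\<Sum>j<n. y j) * s ^ k" by (simp add: sum_distrib_left sum_distrib_right ac_simps)
      finally show ?thesis
        using s(1) y0[OF n0] by (simp add: S_def power_divide divide_simps mult_ac)
    qed
    moreover have "(\<rho> + \<epsilon>) / s > 1" using s by simp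
    ultimately show False using real_arch_pow[of "(\<rho> + \<epsilon>) / s" S] by (meson not_less)
  qed
  have powu: "(\<Sum>j<n. (A ^\<^sub>m k) $$ (i, j) * u j) = \<rho> ^ k * u i" if "i < n" for k i
    by (rule pow_mat_eigenvector[OF A eig that])
  have upos: "u i > 0" if "i < n" for i
  proof -
    have "0 < (\<Sum>j<n. T i j * u j)" using pos[where z = u, OF that i0] u0 by blast
    also have "\<dots> = (\<Sum>k<N. \<Sum>j<n. (A ^\<^sub>m k) $$ (i, j) * u j)"
      by (simp add: T_def sum_distrib_right) (rule sum.swap)
    also have "\<dots> = (\<Sum>k<N. \<rho> ^ k) * u i" using that by (simp add: powu sum_distrib_right)
    finally show ?thesis using u0[of i] by (metis less_eq_real_def mult_zero_right less_irrefl)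
  qed
  have "\<rho> > 0"
  proof -
    obtain i j where ij: "i < n" "j < n" "A $$ (i, j) \<noteq> 0" using nz A by (auto simp: mat_eq_iff)
    then have "(\<Sum>j<n. A $$ (i, j) * u j) > 0"
      using A0[of i] upos by (intro sum_pos2[of _ j]) (auto simp: less_le intro!: mult_nonneg_nonneg)
    then show ?thesis using eig ij upos \<rho>0 by (metis less_eq_real_def mult_zero_left less_irrefl)
  qed
  then show ?thesis using that upos eig by blast
qed

locale perron_cyclic =
  fixes n h :: nat and A :: "real mat" and c :: "nat \<Rightarrow> nat" and M :: nat
    and \<rho> :: real and v :: "nat \<Rightarrow> real"
  assumes A: "A \<in> carrier_mat n n" and nn: "nonneg_matrix A" and n: "n > 0" and h: "h > 0"
    and hA: "homogeneous h c 1 A"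
    and full: "M \<le> m \<Longrightarrow> i < n \<Longrightarrow> j < n \<Longrightarrow> [c j = c i + m] (mod h) \<Longrightarrow> (A ^\<^sub>m m) $$ (i, j) > 0"
    and \<rho>: "\<rho> > 0" and v: "i < n \<Longrightarrow> v i > 0"
    and eigen: "i < n \<Longrightarrow> (\<Sum>j<n. A $$ (i, j) * v j) = \<rho> * v i"
begin

lemma Ak: "A ^\<^sub>m k \<in> carrier_mat n n"
  using A by (rule pow_carrier_mat)

lemma eigen_pow: "i < n \<Longrightarrow> (\<Sum>j<n. (A ^\<^sub>m k) $$ (i, j) * v j) = \<rho> ^ k * v i"
  by (rule pow_mat_eigenvector[OF A eigen])

text \<open>
Conjugation by the Perron vector and division by the Perron root make the powers of \<open>A\<close>
stochastic.
\<close>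

definition W :: "nat \<Rightarrow> nat \<Rightarrow> nat \<Rightarrow> real" where
  "W t i j = (A ^\<^sub>m t) $$ (i, j) * v j / (\<rho> ^ t * v i)"

lemma W_nonneg: "i < n \<Longrightarrow> j < n \<Longrightarrow> W t i j \<ge> 0"
  using nonneg_matrix_pow[OF A nn, of t] Ak[of t] v[of i] v[of j] \<rho>
  by (auto simp: W_def nonneg_matrix_iff intro!: divide_nonneg_nonneg mult_nonneg_nonneg less_imp_le)

lemma W_sum: "i < n \<Longrightarrow> (\<Sum>j<n. W t i j) = 1"
  using eigen_pow[of i t] v[of i] \<rho> by (simp add: W_def flip: sum_divide_distrib)

lemma W_add: "i < n \<Longrightarrow> j < n \<Longrightarrow> W (s + t) i j = (\<Sum>k<n. W s i k * W t k j)"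
proof -
  assume ij: "i < n" "j < n"
  have "W (s + t) i j = (\<Sum>k<n. (A ^\<^sub>m s) $$ (i, k) * (A ^\<^sub>m t) $$ (k, j) * v j / (\<rho> ^ (s + t) * v i))"
    using ij by (simp add: W_def pow_mat_add[OF A] index_mult_mat_sum[OF Ak Ak] sum_distrib_right sum_divide_distrib del: index_mult_mat(1))
  also have "\<dots> = (\<Sum>k<n. W s i k * W t k j)"
  proof (rule sum.cong[OF refl])
    fix k assume "k \<in> {..<n}"
    then have "v k \<noteq> 0" using v[of k] by simp
    then show "(A ^\<^sub>m s) $$ (i, k) * (A ^\<^sub>m t) $$ (k, j) * v j / (\<rho> ^ (s + t) * v i) = W s i k * W t k j"
      by (simp add: W_def power_add mult_ac)
  qed
  finally show ?thesis .
qed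

lemma W_nonzero: "i < n \<Longrightarrow> j < n \<Longrightarrow> W t i j \<noteq> 0 \<Longrightarrow> [c j = c i + t] (mod h)"
  using homogeneousD[OF homogeneous_pow[OF A hA, of t] Ak, of i j] by (auto simp: W_def)

text \<open>
All long walks end with a walk of the fixed length \<open>M\<close>, and the positive entries of \<open>W M\<close> have a
positive minimum.
\<close>

lemma W_lower_bound:
  obtains \<delta> where "0 < \<delta>" "\<delta> \<le> 1"
    "\<And>t i j. M \<le> t \<Longrightarrow> i < n \<Longrightarrow> j < n \<Longrightarrow> [c j = c i + t] (mod h) \<Longrightarrow> \<delta> \<le> W t i j"
proof -
  define P where "P = insert 1 {x. x > 0 \<and> (\<exists>i<n. \<exists>j<n. x = W M i j)}"
  have "P \<subseteq> insert 1 ((\<lambda>(i, j). W M i j) ` ({..<n} \<times> {..<n}))" by (auto simp: P_def)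
  then have fin: "finite P" by (rule finite_subset) simp
  have ne: "P \<noteq> {}" by (simp add: P_def)
  show ?thesis
  proof (rule that[of "Min P"])
    show "0 < Min P" using fin ne by (subst Min_gr_iff) (auto simp: P_def)
    show "Min P \<le> 1" using fin by (intro Min_le) (auto simp: P_def)
    fix t i j assume t: "M \<le> t" and ij: "i < n" "j < n" and cg: "[c j = c i + t] (mod h)"
    have "Min P = (\<Sum>k<n. W (t - M) i k * Min P)"
      using W_sum[OF ij(1)] by (simp flip: sum_distrib_right)
    also have "\<dots> \<le> (\<Sum>k<n. W (t - M) i k * W M k j)"
    proof (rule sum_mono)
      fix k assume "k \<in> {..<n}"
      then have k: "k < n" by simp
      show "W (t - M) i k * Min P \<le> W (t - M) i k * W M k j"
      proof (cases "W (t - M) i k = 0")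
        case False
        then have "[c k + M = c i + (t - M) + M] (mod h)"
          using W_nonzero[OF ij(1) k] by (simp add: cong_add_rcancel_nat)
        then have "[c j = c k + M] (mod h)" using cg t by (metis add.assoc cong_sym cong_trans le_add_diff_inverse2)
        then have "W M k j > 0" using full[of M k j] k ij v \<rho> by (simp add: W_def)
        then have "Min P \<le> W M k j" using fin k ij by (intro Min_le) (auto simp: P_def)
        then show ?thesis using W_nonneg[OF ij(1) k] by (intro mult_left_mono)
      qed simp
    qed
    also have "\<dots> = W t i j" using W_add[OF ij, of "t - M" M] t by simp
    finally show "Min P \<le> W t i j" .
  qed
qed

text \<open>
This is Doeblin's contraction within the classes. A step of length \<open>s\<close> divisible by \<open>h\<close> replaces the
values of a column on a class by averages of these values, and all of these averages give weight
at least \<open>\<delta>\<close> to the same index. Hence the oscillation shrinks by the factor \<open>1 - \<delta>\<close>.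
\<close>

lemma W_mixing:
  assumes "\<epsilon> > 0"
  obtains t\<^sub>0 where "\<And>t i l j. t \<ge> t\<^sub>0 \<Longrightarrow> i < n \<Longrightarrow> l < n \<Longrightarrow> j < n \<Longrightarrow> [c i = c l] (mod h)
    \<Longrightarrow> \<bar>W t i j - W t l j\<bar> \<le> \<epsilon>"
proof -
  obtain \<delta> where \<delta>: "0 < \<delta>" "\<delta> \<le> 1"
    and low: "\<And>t i j. M \<le> t \<Longrightarrow> i < n \<Longrightarrow> j < n \<Longrightarrow> [c j = c i + t] (mod h) \<Longrightarrow> \<delta> \<le> W t i j"
    using W_lower_bound by metis
  define osc where "osc t g \<longleftrightarrow> (\<forall>j<n. \<forall>l\<^sub>0<n. \<exists>lo. \<forall>l<n. [c l = c l\<^sub>0] (mod h) \<longrightarrow>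
      lo \<le> W t l j \<and> W t l j \<le> lo + g)" for t g
  define s where "s = h * M"
  have "M \<le> s" using h by (simp add: s_def)
  have step: "osc (s + t) ((1 - \<delta>) * g)" if osc: "osc t g" for t g
    unfolding osc_def
  proof (intro allI impI)
    fix j l\<^sub>0 assume j: "j < n" and l0: "l\<^sub>0 < n"
    obtain lo where lo: "\<And>l. l < n \<Longrightarrow> [c l = c l\<^sub>0] (mod h) \<Longrightarrow> lo \<le> W t l j \<and> W t l j \<le> lo + g"
      using osc j l0 unfolding osc_def by metis
    define w where "w = W t l\<^sub>0 j"
    have "lo + \<delta> * (w - lo) \<le> W (s + t) l j \<and> W (s + t) l j \<le> lo + \<delta> * (w - lo) + (1 - \<delta>) * g"
      if l: "l < n" and cg: "[c l = c l\<^sub>0] (mod h)" for l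
    proof -
      have *: "[c k = c l\<^sub>0] (mod h)" if "k < n" "W s l k \<noteq> 0" for k
      proof -
        have "[c k = c l + s] (mod h)" using W_nonzero[OF l that] .
        moreover have "[c l + s = c l] (mod h)" by (simp add: s_def cong_sym_eq cong_add_self_iff)
        ultimately show ?thesis using cg by (metis cong_trans)
      qed
      have "[c l\<^sub>0 = c l + s] (mod h)"
        using cg by (metis cong_add_self_iff cong_sym cong_trans dvd_triv_left s_def)
      then have d: "\<delta> \<le> W s l l\<^sub>0" using low[OF \<open>M \<le> s\<close> l l0] by blast
      \<comment> \<open>The weight \<open>\<delta>\<close> on \<open>l\<^sub>0\<close> is common to all rows of the class.\<close>
      have "\<delta> * (w - lo) \<le> W s l l\<^sub>0 * (w - lo)"
        using d lo[OF l0 cong_refl] by (intro mult_right_mono) (auto simp: w_def)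
      also have "\<dots> \<le> (\<Sum>k<n. W s l k * (W t k j - lo))"
        unfolding w_def
      proof (rule member_le_sum[of l\<^sub>0 "{..<n}" "\<lambda>k. W s l k * (W t k j - lo)"])
        fix k assume "k \<in> {..<n} - {l\<^sub>0}"
        then show "0 \<le> W s l k * (W t k j - lo)"
          using W_nonneg[OF l, of k s] lo[of k] *[of k] by (cases "W s l k = 0") auto
      qed (use l0 in auto)
      also have "\<dots> = W (s + t) l j - lo"
        using W_add[OF l j, of s t] W_sum[OF l, of s]
        by (simp add: right_diff_distrib sum_subtractf flip: sum_distrib_right)
      finally have 1: "lo + \<delta> * (w - lo) \<le> W (s + t) l j" by simp
      have "\<delta> * (lo + g - w) \<le> W s l l\<^sub>0 * (lo + g - w)"
        using d lo[OF l0 cong_refl] by (intro mult_right_mono) (auto simp: w_def)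
      also have "\<dots> \<le> (\<Sum>k<n. W s l k * (lo + g - W t k j))"
        unfolding w_def
      proof (rule member_le_sum[of l\<^sub>0 "{..<n}" "\<lambda>k. W s l k * (lo + g - W t k j)"])
        fix k assume "k \<in> {..<n} - {l\<^sub>0}"
        then show "0 \<le> W s l k * (lo + g - W t k j)"
          using W_nonneg[OF l, of k s] lo[of k] *[of k] by (cases "W s l k = 0") auto
      qed (use l0 in auto)
      also have "\<dots> = lo + g - W (s + t) l j"
        using W_add[OF l j, of s t] W_sum[OF l, of s]
        by (simp add: right_diff_distrib sum_subtractf flip: sum_distrib_right)
      finally have "W (s + t) l j \<le> lo + \<delta> * (w - lo) + (1 - \<delta>) * g" by (simp add: algebra_simps)
      then show ?thesis using 1 by simp
    qed
    then show "\<exists>lo. \<forall>l<n. [c l = c l\<^sub>0] (mod h) \<longrightarrow> lo \<le> W (s + t) l j \<and> W (s + t) l j \<le> lo + (1 - \<delta>) * g"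
      by (intro exI[of _ "lo + \<delta> * (w - lo)"]) blast
  qed
  have base: "osc t 1" for t unfolding osc_def
  proof (intro allI impI exI[of _ 0] conjI)
    fix j l assume "j < n" "l < n"
    then show "0 \<le> W t l j" by (intro W_nonneg)
    have "W t l j \<le> (\<Sum>j<n. W t l j)"
      using \<open>j < n\<close> W_nonneg[OF \<open>l < n\<close>] by (intro member_le_sum) auto
    then show "W t l j \<le> 0 + 1" using W_sum[OF \<open>l < n\<close>] by simp
  qed
  have iter: "osc (s * k + t) ((1 - \<delta>) ^ k)" for k t
  proof (induction k)
    case 0
    then show ?case using base by simp
  next
    case (Suc k)
    then show ?case using step[OF Suc] by (simp add: ac_simps)
  qed
  have "\<exists>k. (1 - \<delta>) ^ k < \<epsilon>" using \<delta> assms by (intro real_arch_pow_inv) auto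
  then obtain k where k: "(1 - \<delta>) ^ k < \<epsilon>" by blast
  show ?thesis
  proof (rule that[of "s * k"])
    fix t i l j assume t: "t \<ge> s * k" and "i < n" "l < n" "j < n" "[c i = c l] (mod h)"
    have "osc t ((1 - \<delta>) ^ k)" using iter[of k "t - s * k"] t by simp
    then obtain lo where "\<And>i. i < n \<Longrightarrow> [c i = c l] (mod h) \<Longrightarrow> lo \<le> W t i j \<and> W t i j \<le> lo + (1 - \<delta>) ^ k"
      using \<open>j < n\<close> \<open>l < n\<close> unfolding osc_def by metis
    from this[OF \<open>i < n\<close> \<open>[c i = c l] (mod h)\<close>] this[OF \<open>l < n\<close> cong_refl]
    show "\<bar>W t i j - W t l j\<bar> \<le> \<epsilon>" using k by linarith
  qed
qed

text \<open>
The quotient \<open>f\<close> of \<open>Y v\<close> by \<open>v\<close> is harmonic for the stochastic matrices \<open>W t\<close>. By the maximum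
principle it is constant on everything that can be reached from a point where it is maximal.
\<close>

lemma eigen_of_commuting:
  assumes irr: "irreducible_matrix A" and Y: "Y \<in> carrier_mat n n" and YA: "Y * A = A * Y"
  shows "\<exists>\<sigma>. \<forall>i<n. (\<Sum>j<n. Y $$ (i, j) * v j) = \<sigma> * v i"
proof -
  define f where "f i = (\<Sum>j<n. Y $$ (i, j) * v j) / v i" for i
  have f: "(\<Sum>j<n. Y $$ (i, j) * v j) = f i * v i" if "i < n" for i
    using v[OF that] by (simp add: f_def)
  have harm: "(\<Sum>j<n. W t i j * f j) = f i" if i: "i < n" for t i
  proof -
    have "(\<Sum>j<n. (A ^\<^sub>m t) $$ (i, j) * (f j * v j)) = (\<Sum>k<n. (A ^\<^sub>m t * Y) $$ (i, k) * v k)"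
      using i by (simp add: index_mult_mat_sum[OF Ak Y] sum_distrib_left sum_distrib_right mult.assoc del: index_mult_mat(1) flip: f)
        (rule sum.swap)
    also have "A ^\<^sub>m t * Y = Y * A ^\<^sub>m t" using pow_mat_commute[OF A Y] YA by simp
    also have "(\<Sum>k<n. (Y * A ^\<^sub>m t) $$ (i, k) * v k) = (\<Sum>j<n. Y $$ (i, j) * (\<Sum>k<n. (A ^\<^sub>m t) $$ (j, k) * v k))"
      using i by (simp add: index_mult_mat_sum[OF Y Ak] sum_distrib_left sum_distrib_right mult.assoc del: index_mult_mat(1))
        (rule sum.swap)
    also have "\<dots> = (\<Sum>j<n. Y $$ (i, j) * (\<rho> ^ t * v j))"
      by (intro sum.cong) (auto simp: eigen_pow)
    also have "\<dots> = \<rho> ^ t * (\<Sum>j<n. Y $$ (i, j) * v j)"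
      by (simp add: sum_distrib_left ac_simps)
    also have "\<dots> = \<rho> ^ t * (f i * v i)" by (simp only: f[OF i])
    finally have eq: "(\<Sum>j<n. (A ^\<^sub>m t) $$ (i, j) * (f j * v j)) = \<rho> ^ t * (f i * v i)" .
    have "(\<Sum>j<n. W t i j * f j) = (\<Sum>j<n. (A ^\<^sub>m t) $$ (i, j) * (f j * v j)) / (\<rho> ^ t * v i)"
      by (simp add: W_def sum_divide_distrib ac_simps)
    also have "\<dots> = f i" unfolding eq using v[OF i] \<rho> by simp
    finally show ?thesis .
  qed
  have "Max (f ` {..<n}) \<in> f ` {..<n}" using n by (intro Max_in) auto
  then obtain i where i: "i < n" "f i = Max (f ` {..<n})" by auto
  have le: "f j \<le> f i" if "j < n" for j unfolding i(2) using that by (intro Max_ge) auto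
  have "f j = f i" if j: "j < n" for j
  proof -
    obtain t where t: "(A ^\<^sub>m t) $$ (i, j) > 0" using irreducible_pow_entry_pos[OF A nn irr i(1) j] by blast
    have "(\<Sum>j<n. W t i j * (f i - f j)) = 0"
      using harm[OF i(1), of t] W_sum[OF i(1), of t]
      by (simp add: right_diff_distrib sum_subtractf flip: sum_distrib_right)
    then have "W t i j * (f i - f j) = 0"
      using j le W_nonneg[OF i(1)] by (subst (asm) sum_nonneg_eq_0_iff) auto
    moreover have "W t i j > 0" using t v[OF i(1)] v[OF j] \<rho> by (simp add: W_def)
    ultimately show ?thesis by simp
  qed
  then show ?thesis using f by (intro exI[of _ "f i"]) simp
qed

text \<open>
Up to a positive factor, the \<open>(i, j)\<close> entry of \<open>N A ^ t\<close> is the sum of the products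
\<open>N\<^sub>i\<^sub>l v\<^sub>l W t l j\<close> over \<open>l\<close>, where only the \<open>l\<close> of one class contribute. As the values \<open>W t l j\<close> are
almost equal on that class and bounded below, the sum is close to \<open>\<mu> v\<^sub>i\<close> times one of them.
\<close>

lemma eventually_nonneg_mult_pow:
  assumes N: "N \<in> carrier_mat n n" and hN: "homogeneous h c a N" and \<mu>: "\<mu> > 0"
    and eig: "\<And>i. i < n \<Longrightarrow> (\<Sum>j<n. N $$ (i, j) * v j) = \<mu> * v i"
  shows "\<exists>t\<^sub>0. \<forall>t\<ge>t\<^sub>0. nonneg_matrix (N * A ^\<^sub>m t)"
proof -
  obtain \<delta> where \<delta>: "0 < \<delta>"
    and low: "\<And>t i j. M \<le> t \<Longrightarrow> i < n \<Longrightarrow> j < n \<Longrightarrow> [c j = c i + t] (mod h) \<Longrightarrow> \<delta> \<le> W t i j"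
    using W_lower_bound by metis
  define S where "S = 1 + (\<Sum>i<n. \<Sum>l<n. \<bar>N $$ (i, l) * v l\<bar>)"
  have S: "S > 0" unfolding S_def by (intro add_pos_nonneg sum_nonneg) auto
  define b where "b = Min (v ` {..<n})"
  have b0: "b > 0" unfolding b_def using v n by (subst Min_gr_iff) auto
  have b: "b \<le> v i" if "i < n" for i unfolding b_def using that by (intro Min_le) auto
  define \<epsilon> where "\<epsilon> = \<mu> * b * \<delta> / S"
  have "\<epsilon> > 0" using \<mu> b0 \<delta> S by (simp add: \<epsilon>_def)
  then obtain t\<^sub>1 where mix: "\<And>t i l j. t \<ge> t\<^sub>1 \<Longrightarrow> i < n \<Longrightarrow> l < n \<Longrightarrow> j < n \<Longrightarrow> [c i = c l] (mod h)
    \<Longrightarrow> \<bar>W t i j - W t l j\<bar> \<le> \<epsilon>"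
    using W_mixing by metis
  have "nonneg_matrix (N * A ^\<^sub>m t)" if t: "t \<ge> max M t\<^sub>1" for t
    unfolding nonneg_matrix_iff[OF mult_carrier_mat[OF N Ak]]
  proof (intro allI impI)
    fix i j assume ij: "i < n" "j < n"
    show "0 \<le> (N * A ^\<^sub>m t) $$ (i, j)"
    proof (cases "(N * A ^\<^sub>m t) $$ (i, j) = 0")
      case False
      then have cg: "[c j = c i + (a + 1 * t)] (mod h)"
        using homogeneousD[OF homogeneous_mult[OF N Ak hN homogeneous_pow[OF A hA]] mult_carrier_mat[OF N Ak] ij]
        by blast
      have "\<exists>l<n. N $$ (i, l) \<noteq> 0"
      proof (rule ccontr)
        assume "\<not> (\<exists>l<n. N $$ (i, l) \<noteq> 0)"
        then have "\<mu> * v i = 0" using eig[OF ij(1)] by simp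
        then show False using \<mu> v[OF ij(1)] by simp
      qed
      then obtain k where k: "k < n" "N $$ (i, k) \<noteq> 0" by blast
      have ck: "[c l = c i + a] (mod h)" if "l < n" "N $$ (i, l) \<noteq> 0" for l
        using homogeneousD[OF hN N ij(1) that] .
      have "[c k + t = c i + a + t] (mod h)" using ck[OF k] by (simp add: cong_add_rcancel_nat)
      then have "[c j = c k + t] (mod h)" using cg by (metis add.assoc cong_sym cong_trans mult_1)
      then have Wk: "\<delta> \<le> W t k j" using low k ij t by simp
      have entry: "(A ^\<^sub>m t) $$ (l, j) = \<rho> ^ t / v j * (v l * W t l j)" if "l < n" for l
        using v[OF that] v[OF ij(2)] \<rho> by (simp add: W_def)
      have "(N * A ^\<^sub>m t) $$ (i, j) = \<rho> ^ t / v j * (\<Sum>l<n. N $$ (i, l) * v l * W t l j)"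
        using ij by (simp add: index_mult_mat_sum[OF N Ak] entry sum_distrib_left ac_simps del: index_mult_mat(1))
      moreover have "(\<Sum>l<n. N $$ (i, l) * v l * W t l j) \<ge> 0"
      proof -
        have "(\<Sum>l<n. N $$ (i, l) * v l * W t l j) =
            (\<Sum>l<n. N $$ (i, l) * v l) * W t k j + (\<Sum>l<n. N $$ (i, l) * v l * (W t l j - W t k j))"
          by (simp add: right_diff_distrib sum_subtractf sum_distrib_right)
        moreover have "(\<Sum>l<n. N $$ (i, l) * v l) * W t k j \<ge> \<mu> * b * \<delta>"
          unfolding eig[OF ij(1)] using \<mu> b[OF ij(1)] b0 Wk \<delta> by (intro mult_mono) auto
        moreover have "\<bar>\<Sum>l<n. N $$ (i, l) * v l * (W t l j - W t k j)\<bar> \<le> \<mu> * b * \<delta>"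
        proof -
          have "\<bar>\<Sum>l<n. N $$ (i, l) * v l * (W t l j - W t k j)\<bar>
              \<le> (\<Sum>l<n. \<bar>N $$ (i, l) * v l * (W t l j - W t k j)\<bar>)" by (rule sum_abs)
          also have "\<dots> \<le> (\<Sum>l<n. \<bar>N $$ (i, l) * v l\<bar> * \<epsilon>)"
          proof (rule sum_mono)
            fix l assume "l \<in> {..<n}"
            then have l: "l < n" by simp
            show "\<bar>N $$ (i, l) * v l * (W t l j - W t k j)\<bar> \<le> \<bar>N $$ (i, l) * v l\<bar> * \<epsilon>"
            proof (cases "N $$ (i, l) = 0")
              case False
              then have "[c l = c k] (mod h)" using ck[OF l] ck[OF k] by (metis cong_sym cong_trans)
              then have "\<bar>W t l j - W t k j\<bar> \<le> \<epsilon>" using mix l k ij t by simp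
              then show ?thesis by (simp only: abs_mult) (intro mult_left_mono; simp)
            qed simp
          qed
          also have "\<dots> = (\<Sum>l<n. \<bar>N $$ (i, l) * v l\<bar>) * \<epsilon>" by (simp add: sum_distrib_right)
          also have "\<dots> \<le> S * \<epsilon>"
          proof -
            have "(\<Sum>l<n. \<bar>N $$ (i, l) * v l\<bar>) \<le> (\<Sum>i<n. \<Sum>l<n. \<bar>N $$ (i, l) * v l\<bar>)"
              using ij(1) by (intro member_le_sum[of i "{..<n}" "\<lambda>i. \<Sum>l<n. \<bar>N $$ (i, l) * v l\<bar>"]) (auto intro: sum_nonneg)
            then show ?thesis using \<open>\<epsilon> > 0\<close> by (intro mult_right_mono) (auto simp: S_def)
          qed
          also have "\<dots> = \<mu> * b * \<delta>" using S by (simp add: \<epsilon>_def)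
          finally show ?thesis .
        qed
        ultimately show ?thesis by linarith
      qed
      ultimately show ?thesis using \<rho> v[OF ij(2)] by simp
    qed simp
  qed
  then show ?thesis by blast
qed

text \<open>
For \<open>s < p\<close> and large \<open>q\<close>, \<open>Y ^ (p q + s)\<close> is one of finitely many homogeneous matrices, with \<open>v\<close> as
an eigenvector, times a power of \<open>A\<close>.
\<close>

lemma eventually_nonneg_root:
  assumes Y: "Y \<in> carrier_mat n n" and YA: "Y ^\<^sub>m p = A" and p: "p > 0"
    and \<sigma>: "\<sigma> > 0" and eig: "\<And>i. i < n \<Longrightarrow> (\<Sum>j<n. Y $$ (i, j) * v j) = \<sigma> * v i"
    and hom: "\<And>t. t \<ge> t\<^sub>0 \<Longrightarrow> homogeneous h c (t + r) (A ^\<^sub>m t * Y)"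
  shows "eventually_nonneg_matrix Y"
proof -
  have Yk: "Y ^\<^sub>m k \<in> carrier_mat n n" for k using Y by (rule pow_carrier_mat)
  have AY: "A * Y = Y * A" using pow_mat_commute[OF Y Y refl, of p] YA by simp
  have eigY: "(\<Sum>j<n. (Y ^\<^sub>m k) $$ (i, j) * v j) = \<sigma> ^ k * v i" if "i < n" for i k
    by (rule pow_mat_eigenvector[OF Y eig that])
  \<comment> \<open>Each of the \<open>s\<close> factors \<open>Y\<close> needs its own \<open>A ^ t\<^sub>0\<close> to become homogeneous.\<close>
  define N where "N s = A ^\<^sub>m (t\<^sub>0 * p) * Y ^\<^sub>m s" for s
  have N: "N s \<in> carrier_mat n n" for s unfolding N_def by (rule mult_carrier_mat[OF Ak Yk])
  have Npow: "N s = Y ^\<^sub>m (p * (t\<^sub>0 * p) + s)" for s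
    unfolding N_def by (simp add: pow_mat_add[OF Y] pow_mat_mult[OF Y, of p] YA)
  have hN: "\<exists>a. homogeneous h c a (N s)" if "s < p" for s
  proof -
    have "(A ^\<^sub>m t\<^sub>0 * Y) ^\<^sub>m s = A ^\<^sub>m (t\<^sub>0 * s) * Y ^\<^sub>m s"
      using pow_mat_mult_distrib[OF Ak Y pow_mat_commute[OF A Y AY], of t\<^sub>0 s] by (simp add: pow_mat_mult[OF A])
    then have "homogeneous h c ((t\<^sub>0 + r) * s) (A ^\<^sub>m (t\<^sub>0 * s) * Y ^\<^sub>m s)"
      using homogeneous_pow[OF mult_carrier_mat[OF Ak Y] hom[OF order_refl], of s] by simp
    from homogeneous_mult[OF Ak mult_carrier_mat[OF Ak Yk] homogeneous_pow[OF A hA] this]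
    have "homogeneous h c (1 * (t\<^sub>0 * (p - s)) + (t\<^sub>0 + r) * s) (A ^\<^sub>m (t\<^sub>0 * (p - s)) * (A ^\<^sub>m (t\<^sub>0 * s) * Y ^\<^sub>m s))" .
    also have "A ^\<^sub>m (t\<^sub>0 * (p - s)) * (A ^\<^sub>m (t\<^sub>0 * s) * Y ^\<^sub>m s) = N s"
      unfolding assoc_mult_mat[OF Ak Ak Yk, symmetric] pow_mat_add[OF A, symmetric] N_def
      using that by (simp flip: add_mult_distrib2)
    finally show ?thesis by blast
  qed
  have "\<exists>T. \<forall>t\<ge>T. nonneg_matrix (N s * A ^\<^sub>m t)" if s: "s < p" for s
  proof -
    obtain a where "homogeneous h c a (N s)" using hN[OF s] by blast
    then show ?thesis
      using eigY[of _ "p * (t\<^sub>0 * p) + s"] \<sigma>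
      by (intro eventually_nonneg_mult_pow[OF N, of _ _ "\<sigma> ^ (p * (t\<^sub>0 * p) + s)"]) (auto simp: Npow)
  qed
  then obtain T where T: "\<And>s t. s < p \<Longrightarrow> t \<ge> T s \<Longrightarrow> nonneg_matrix (N s * A ^\<^sub>m t)" by metis
  define T' where "T' = (\<Sum>s<p. T s)"
  have T': "T s \<le> T'" if "s < p" for s unfolding T'_def using that by (intro member_le_sum) auto
  show ?thesis unfolding eventually_nonneg_matrix_def
  proof (intro exI allI impI)
    fix k assume k: "k \<ge> p * (t\<^sub>0 * p + T')"
    define s where "s = k mod p"
    have s: "s < p" using p by (simp add: s_def)
    have "k div p \<ge> t\<^sub>0 * p + T'" using k p by (simp add: less_eq_div_iff_mult_less_eq mult.commute)
    then obtain t where t: "k div p = t\<^sub>0 * p + T' + t" using le_Suc_ex by blast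
    have "k = p * (k div p) + s" by (simp add: s_def)
    then have "k = (p * (t\<^sub>0 * p) + s) + p * (T' + t)" unfolding t by (simp add: algebra_simps)
    then have "Y ^\<^sub>m k = N s * A ^\<^sub>m (T' + t)"
      using pow_mat_add[OF Y, of "p * (t\<^sub>0 * p) + s" "p * (T' + t)"] by (simp only: Npow pow_mat_mult[OF Y, of p] YA)
    then show "nonneg_matrix (Y ^\<^sub>m k)" using T[OF s, of "T' + t"] T'[OF s] by simp
  qed
qed

end

section \<open>Eventually nonnegative roots of imprimitive matrices\<close>

lemma homogeneous_smult:
  fixes N :: "'a::mult_zero mat"
  shows "homogeneous h c a N \<Longrightarrow> homogeneous h c a (b \<cdot>\<^sub>m N)"
  unfolding homogeneous_def by (metis index_smult_mat mult_zero_right)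

theorem corollary3p5:
  fixes A :: "real mat" and n h p :: nat
  assumes "A \<in> carrier_mat n n"
    and "nonneg_matrix A"
    and "irreducible_matrix A"
    and "imprimitive_matrix A"
    and "h = cyclic_index A"
    and "p > 1"
  shows "(\<exists>X :: real mat. is_root_mat p A X \<and> eventually_nonneg_matrix X) \<longleftrightarrow>
    (\<exists>X :: real mat. is_root_mat p A X) \<and> gcd h p = 1"
proof -
  note A = assms(1) and nn = assms(2) and irr = assms(3) and p = \<open>p > 1\<close>
  have h: "h = imprimitivity_index (mat_digraph A)"
    using cyclic_index_eq_imprimitivity_index[OF assms(1-4)] assms(5) by simp
  then have h0: "h > 0" using assms(4) by (simp add: imprimitive_matrix_def)
  have root: "is_root_mat p A X \<longleftrightarrow> X \<in> carrier_mat n n \<and> X ^\<^sub>m p = A" for X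
    using A by (auto simp: is_root_mat_def)
  have p0: "p > 0" using p by simp
  have n0: "0 < n" using irreducible_dim_pos[OF A irr] .
  obtain c M where hA: "homogeneous h c 1 A" and full: "\<And>m i j. M \<le> m \<Longrightarrow> i < n \<Longrightarrow> j < n
      \<Longrightarrow> [c j = c i + m] (mod h) \<Longrightarrow> (A ^\<^sub>m m) $$ (i, j) > 0"
    using cyclic_classes[OF A nn irr h h0] by metis
  have sufficient: "\<exists>Y. is_root_mat p A Y \<and> eventually_nonneg_matrix Y"
    if "is_root_mat p A X" and "gcd h p = 1" for X
  proof -
    have X: "X \<in> carrier_mat n n" "X ^\<^sub>m p = A" using that(1) by (simp_all add: root)
    have cop: "coprime h p" using that(2) by (simp add: coprime_iff_gcd_eq_1)
    obtain Y r t\<^sub>0 where Y: "Y \<in> carrier_mat n n" and YA: "Y ^\<^sub>m p = A"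
      and hom: "\<And>t. t \<ge> t\<^sub>0 \<Longrightarrow> homogeneous h c (t + r) (A ^\<^sub>m t * Y)"
      using homogeneous_root[OF X p0 h0 cop hA] by metis
    have "A \<noteq> 0\<^sub>m n n"
    proof
      assume "A = 0\<^sub>m n n"
      then have "A ^\<^sub>m Suc k = 0\<^sub>m n n" for k
        using right_mult_zero_mat[OF pow_carrier_mat[OF A]] by simp
      moreover have "(A ^\<^sub>m (h * Suc M)) $$ (0, 0) > 0"
        using n0 h0 by (intro full) (auto simp: cong_add_self_iff simp del: mult_Suc_right
            intro: order_trans[OF _ mult_le_mono1[of 1 h "Suc M"]])
      moreover have "h * Suc M = Suc (h * Suc M - 1)" using h0 by simp
      ultimately show False using n0 by (metis index_zero_mat(1) less_irrefl)
    qed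
    then obtain \<rho> v where \<rho>: "\<rho> > 0" and v: "\<And>i. i < n \<Longrightarrow> v i > 0"
      and eigen: "\<And>i. i < n \<Longrightarrow> (\<Sum>j<n. A $$ (i, j) * v j) = \<rho> * v i"
      using perron_eigenvector[OF A nn irr] by metis
    interpret perron_cyclic n h A c M \<rho> v
      by unfold_locales (use A nn n0 h0 hA full \<rho> v eigen in auto)
    have "Y * A = A * Y" using pow_mat_commute[OF Y Y refl, of p] YA by simp
    then obtain \<sigma> where \<sigma>: "\<And>i. i < n \<Longrightarrow> (\<Sum>j<n. Y $$ (i, j) * v j) = \<sigma> * v i"
      using eigen_of_commuting[OF irr Y] by metis
    have "(\<Sum>j<n. A $$ (0, j) * v j) = \<sigma> ^ p * v 0"
      using pow_mat_eigenvector[OF Y \<sigma> n0, of p] unfolding YA .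
    then have "\<sigma> ^ p * v 0 = \<rho> * v 0" unfolding eigen[OF n0] by (rule sym)
    then have \<sigma>p: "\<sigma> ^ p = \<rho>" using v[OF n0] by simp
    show ?thesis
    proof (cases "\<sigma> > 0")
      case True
      then show ?thesis
        using eventually_nonneg_root[OF Y YA _ True \<sigma> hom] Y YA p by (auto simp: root)
    next
      case False
      define Z where "Z = (- 1) \<cdot>\<^sub>m Y"
      have Z: "Z \<in> carrier_mat n n" using Y by (simp add: Z_def)
      have "\<sigma> < 0" using False \<sigma>p \<rho> p by (cases "\<sigma> = 0") (auto simp: power_0_left)
      then have "even p" using \<sigma>p \<rho> by (metis less_asym power_less_zero_eq)
      then have ZA: "Z ^\<^sub>m p = A"
        using A YA unfolding Z_def smult_pow_mat[OF Y] by (auto intro!: eq_matI)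
      have "homogeneous h c (t + r) (A ^\<^sub>m t * Z)" if "t \<ge> t\<^sub>0" for t
        unfolding Z_def mult_smult_distrib[OF pow_carrier_mat[OF A] Y]
        by (rule homogeneous_smult[OF hom[OF that]])
      moreover have "(\<Sum>j<n. Z $$ (i, j) * v j) = (- \<sigma>) * v i" if "i < n" for i
        using \<sigma>[OF that] Y that by (simp add: Z_def sum_negf)
      ultimately have "eventually_nonneg_matrix Z"
        using eventually_nonneg_root[OF Z ZA, of "- \<sigma>"] \<open>\<sigma> < 0\<close> p by auto
      then show ?thesis using Z ZA by (auto simp: root)
    qed
  qed
  have necessary: "gcd h p = 1" if "is_root_mat p A X" "eventually_nonneg_matrix X" for X
    using coprime_of_eventually_nonneg_root[OF A nn irr h h0 _ _ that(2) p] that(1) by (simp add: root)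
  show ?thesis
    by (intro iffI conjI; elim exE conjE) (rule exI, assumption, erule (1) necessary, erule (1) sufficient)
qed

end
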